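(* Let $k\ge 0$ and $m_1,\dots,m_k\ge 0$ be integers such that $l=\left(\sum_{i=1}^k m_i\right)-k+1\ge 0$. Every (combed) tree $T$ with nodes $N_1,\dots,N_k$, where $N_i$ has $m_i$ inputs, is represented by a unique morphism $$\xi_T: X_{m_1}\otimes\cdots\otimes X_{m_k}\longrightarrow X_l$$ of $K\mathbf{1}$ (the morphism $\xi_T$ described in the context), and this morphism is allowable. Conversely, any allowable morphism $X_{m_1}\otimes\cdots\otimes X_{m_k}\to X_l$ of $K\mathbf{1}$ represents a unique tree, i.e. it equals $\xi_T$ for a unique such tree $T$ (up to isomorphism). When $k=0$ the domain is $I$.
   Context: **Shapes.** Shapes are formal objects generated by: $I$ and $1$ are shapes; if $S,T$ are shapes so are $S\otimes T$ and $[S,T]$. We work strictly: $(T\otimes S)\otimes R=T\otimes(S\otimes R)$, $T\otimes I=T=I\otimes T$. Each shape $T$ has a list $v(T)$ of signs (its variables with their variances): $v(I)=\emptyset$, $v(1)=\{+\}$, $v(T\otimes S)=v(T)\sqcup v(S)$, $v([T,S])=v(T)^{\mathrm{op}}\sqcup v(S)$, where $\sqcup$ is concatenation and $(-)^{\mathrm{op}}$ reverses all signs. **Graphs.** A (Kelly–Mac Lane) graph $T\to S$ is a fixed-point-free pairing of the variables of $T$ and $S$ such that paired elements ("mates") have opposite variances in $v(T)^{\mathrm{op}}\sqcup v(S)$. Graphs $f:T\to S$, $g:S\to R$ compose to $gf:T\to R$ by gluing along the variables of $S$ and following paths (closed loops arising among the variables of $S$ are discarded). $K\mathbf{1}$ is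 the category of shapes and graphs. For $f:T\to T'$, $g:S\to S'$, both $f\otimes g:T\otimes S\to T'\otimes S'$ and $[f,g]:[T',S]\to[T,S']$ are given by the disjoint union of the pairings of $f$ and $g$. **Allowable morphisms.** The smallest class of morphisms of $K\mathbf{1}$ that contains, for all shapes $T,S$: the identities; $c:T\otimes S\to S\otimes T$ (pairing the two copies of $T$ variable by variable, and likewise the two copies of $S$); $d:T\to[S,T\otimes S]$ (pairing the two copies of $T$, and the two copies of $S$ in the codomain); $e:[T,S]\otimes T\to S$ (pairing the two copies of $T$ in the domain, and the two copies of $S$); and that is closed under $f\otimes g$, $[f,g]$ and composition. (The associativity and unit constraints are identities in the strict setting.) **Notation.** $X_m=[1^{\otimes m},1]$ for $m\ge 0$, with $1^{\otimes 0}=I$. **Trees.** A planar tree is (inductively) either the null tree (a single edge with no nodes, which is both its only leaf and its root), or a root node having $n\ge 0$ ordered inputs and one output (the root of the tree), with a planar tree attached by its root to each input. Its leaves are the edges not attached to the output of any node (a node may have $0$ inputs), ordered left to right. A tree (combed tree with ordered nodes) is a triple $(T,\rho,\tau)$ with $T$ a planar tree with $k$ nodes and $l$ leaves, $\rho\in S_l$ a permutation, and $\tau$ a bijection from the nodes to $\{1,\dots,k\}$. Write $N_i=\tau^{-1}(i)$, and call the leaf in planar position $i$ the $\rho(i)$-th leaf of the tree. Trees are considered up to isomorphism preserving all this data. **The morphism $\xi_T$.** Let $N_i$ have $m_i$ inputs. Write $X_{m_i}=[A_{i1}\otimes\cdots\otimes A_{im_i},A_i]$ and $X_l=[B_1\otimes\cdots\otimes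 B_l,B]$, with all $A_{ij},A_i,B_p,B$ equal to $1$. In $\xi_T$: $A_{ij}$ is the mate of $A_r$ if the $j$th input of $N_i$ is joined to the output of $N_r$; $A_{ij}$ is the mate of $B_p$ if the $j$th input of $N_i$ is the $p$th leaf of $T$; $A_r$ is the mate of $B$ if the output of $N_r$ is the root of $T$. For the null tree ($k=0$, $l=1$), $B_1$ is the mate of $B$. *)

theory Defs
  imports "HOL-Library.FuncSet" "HOL-Combinatorics.Permutations"
begin

(* Strict associativity and strict units make the shapes the free monoid (under tensor) on the
   shapes that are 1 or of the form [T,S].  A shape is therefore a list of such primes: I is the
   empty list, tensor is append, and both strictness laws hold as equalities.  No other
   identifications are made; e.g. [I,S] and S are different shapes. *)
datatype prime_shape = One | Hom "prime_shape list" "prime_shape list"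

type_synonym shape = "prime_shape list"

abbreviation unit_shape :: shape ("\<I>") where "\<I> \<equiv> []"

abbreviation one_shape :: shape ("\<one>\<^sub>s") where "\<one>\<^sub>s \<equiv> [One]"

abbreviation tensor :: "shape \<Rightarrow> shape \<Rightarrow> shape" (infixr "\<otimes>\<^sub>s" 70)
  where "T \<otimes>\<^sub>s S \<equiv> T @ S"

abbreviation ihom :: "shape \<Rightarrow> shape \<Rightarrow> shape" ("\<lblot>_, _\<rblot>")
  where "\<lblot>T, S\<rblot> \<equiv> [Hom T S]"

abbreviation tensor_list :: "shape list \<Rightarrow> shape" where "tensor_list Ts \<equiv> concat Ts"

definition X :: "nat \<Rightarrow> shape" where
  "X n = \<lblot>tensor_list (replicate n \<one>\<^sub>s), \<one>\<^sub>s\<rblot>"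

(* Signs: True is +, False is -. *)
type_synonym signs = "bool list"

abbreviation op_signs :: "signs \<Rightarrow> signs" where "op_signs \<equiv> map Not"

fun v_prime :: "prime_shape \<Rightarrow> signs" where
  "v_prime One = [True]"
| "v_prime (Hom T S) = op_signs (concat (map v_prime T)) @ concat (map v_prime S)"

definition v :: "shape \<Rightarrow> signs" where "v T = concat (map v_prime T)"

lemma v_unit: "v \<I> = []" by (simp add: v_def)
lemma v_one: "v \<one>\<^sub>s = [True]" by (simp add: v_def)
lemma v_tensor: "v (T \<otimes>\<^sub>s S) = v T @ v S" by (simp add: v_def)
lemma v_ihom: "v \<lblot>T, S\<rblot> = op_signs (v T) @ v S" by (simp add: v_def)

abbreviation nv :: "shape \<Rightarrow> nat" where "nv T \<equiv> length (v T)"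

(* In a graph T -> S, Inl i is the i-th variable of T and Inr j the j-th variable of S, counted
   from 0.  A pairing is given by its (symmetric) relation "x and y are mates". *)
type_synonym variable = "nat + nat"
type_synonym graph = "(variable \<times> variable) set"

definition vars :: "shape \<Rightarrow> shape \<Rightarrow> variable set" where
  "vars T S = {..<nv T} <+> {..<nv S}"

(* The sign in op (v T) @ v S. *)
definition variance :: "shape \<Rightarrow> shape \<Rightarrow> variable \<Rightarrow> bool" where
  "variance T S = case_sum (\<lambda>i. \<not> v T ! i) (\<lambda>j. v S ! j)"

definition K1_graph :: "shape \<Rightarrow> shape \<Rightarrow> graph \<Rightarrow> bool" where
  "K1_graph T S f \<longleftrightarrow>
     f \<subseteq> vars T S \<times> vars T S \<and> sym f \<and> irrefl f \<and>
     (\<forall>x\<in>vars T S. \<exists>!y. (x, y) \<in> f) \<and>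
     (\<forall>(x, y)\<in>f. variance T S x \<noteq> variance T S y)"

definition join :: "(variable \<times> variable) set \<Rightarrow> graph" where
  "join E = E \<union> E\<inverse>"

definition id_graph :: "shape \<Rightarrow> graph" where
  "id_graph T = join {(Inl i, Inr i) | i. i < nv T}"

(* T (x) S -> S (x) T *)
definition c_graph :: "shape \<Rightarrow> shape \<Rightarrow> graph" where
  "c_graph T S = join ({(Inl i, Inr (nv S + i)) | i. i < nv T} \<union>
                       {(Inl (nv T + j), Inr j) | j. j < nv S})"

(* T -> [S, T (x) S]; the codomain has the variables of S, T, S in this order *)
definition d_graph :: "shape \<Rightarrow> shape \<Rightarrow> graph" where
  "d_graph T S = join ({(Inl i, Inr (nv S + i)) | i. i < nv T} \<union>
                       {(Inr j, Inr (nv S + nv T + j)) | j. j < nv S})"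

(* [T,S] (x) T -> S; the domain has the variables of T, S, T in this order *)
definition e_graph :: "shape \<Rightarrow> shape \<Rightarrow> graph" where
  "e_graph T S = join ({(Inl i, Inl (nv T + nv S + i)) | i. i < nv T} \<union>
                       {(Inl (nv T + j), Inr j) | j. j < nv S})"

(* f : T -> T' and any g; the variables of g are moved past those of T and T' *)
definition tensor_graph :: "shape \<Rightarrow> shape \<Rightarrow> graph \<Rightarrow> graph \<Rightarrow> graph" where
  "tensor_graph T T' f g = f \<union> (let r = map_sum ((+) (nv T)) ((+) (nv T')) in map_prod r r ` g)"

(* f : T -> T' and g : S -> S' give [T',S] -> [T,S'], so T and T' change sides *)
definition hom_graph :: "shape \<Rightarrow> shape \<Rightarrow> graph \<Rightarrow> graph \<Rightarrow> graph" where
  "hom_graph T T' f g =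
     (let s = case_sum Inr Inl; r = map_sum ((+) (nv T')) ((+) (nv T))
      in map_prod s s ` f \<union> map_prod r r ` g)"

datatype glued = Dom nat | Mid nat | Cod nat

(* The composite gf.  Gluing gives a graph on the variables of T, S and R in which those of T and R
   have degree 1 and those of S have one edge from f and one from g.  Its components are paths
   joining two variables of T and R, and closed loops among the variables of S.  So two distinct
   outer variables are joined by a path iff they are related by the transitive closure. *)
definition comp_graph :: "graph \<Rightarrow> graph \<Rightarrow> graph" where
  "comp_graph g f =
     (let F = map_prod (case_sum Dom Mid) (case_sum Dom Mid) ` f;
          G = map_prod (case_sum Mid Cod) (case_sum Mid Cod) ` g;
          outer = case_sum Dom Cod
      in {(x, y). x \<noteq> y \<and> (outer x, outer y) \<in> (F \<union> G)\<^sup>+})"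

inductive allowable :: "shape \<Rightarrow> shape \<Rightarrow> graph \<Rightarrow> bool" where
  allowable_id: "allowable T T (id_graph T)"
| allowable_c: "allowable (T \<otimes>\<^sub>s S) (S \<otimes>\<^sub>s T) (c_graph T S)"
| allowable_d: "allowable T \<lblot>S, T \<otimes>\<^sub>s S\<rblot> (d_graph T S)"
| allowable_e: "allowable (\<lblot>T, S\<rblot> \<otimes>\<^sub>s T) S (e_graph T S)"
| allowable_tensor: "allowable T T' f \<Longrightarrow> allowable S S' g \<Longrightarrow>
    allowable (T \<otimes>\<^sub>s S) (T' \<otimes>\<^sub>s S') (tensor_graph T T' f g)"
| allowable_hom: "allowable T T' f \<Longrightarrow> allowable S S' g \<Longrightarrow>
    allowable \<lblot>T', S\<rblot> \<lblot>T, S'\<rblot> (hom_graph T T' f g)"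
| allowable_comp: "allowable T S f \<Longrightarrow> allowable S R g \<Longrightarrow> allowable T R (comp_graph g f)"

(* Planar trees have no nontrivial automorphisms, so the datatype is the set of isomorphism classes
   of planar trees. *)
datatype ptree = Null | Node "ptree list"

(* An edge is addressed by the input positions (from 0) on the way to it from the root edge, which
   is []; a node by the address of its output.  So the j-th input of the node a is the edge a @ [j];
   it is joined to the output of the node b iff b = a @ [j]. *)
type_synonym address = "nat list"

primrec nodes :: "ptree \<Rightarrow> address set" where
  "nodes Null = {}"
| "nodes (Node ts) = insert [] (\<Union>j<length ts. (#) j ` (map nodes ts ! j))"

primrec leaves :: "ptree \<Rightarrow> address list" where
  "leaves Null = [[]]"
| "leaves (Node ts) =
     concat (map (\<lambda>(j, as). map ((#) j) as) (enumerate 0 (map leaves ts)))"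

fun inputs :: "ptree \<Rightarrow> address \<Rightarrow> nat" where
  "inputs (Node ts) [] = length ts"
| "inputs (Node ts) (j # a) = inputs (ts ! j) a"
| "inputs Null a = 0"

(* (T, rho, tau), with leaves, nodes and variables numbered from 0.  Taking tau extensional (and rho
   the identity outside {..<l}) makes isomorphism of these triples the same as equality. *)
type_synonym tree = "ptree \<times> (nat \<Rightarrow> nat) \<times> (address \<Rightarrow> nat)"

fun combed_tree :: "tree \<Rightarrow> bool" where
  "combed_tree (T, \<rho>, \<tau>) \<longleftrightarrow>
     \<rho> permutes {..<length (leaves T)} \<and>
     bij_betw \<tau> (nodes T) {..<card (nodes T)} \<and> \<tau> \<in> extensional (nodes T)"

(* The tree has length m nodes, and its i-th node has m ! i inputs. *)
fun tree_inputs :: "nat list \<Rightarrow> tree \<Rightarrow> bool" where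
  "tree_inputs m (T, \<rho>, \<tau>) \<longleftrightarrow>
     card (nodes T) = length m \<and> (\<forall>a\<in>nodes T. inputs T a = m ! \<tau> a)"

definition X_tensor :: "nat list \<Rightarrow> shape" where
  "X_tensor m = tensor_list (map X m)"

(* A_i0, ..., A_i(m_i - 1), A_i are consecutive variables of the domain, preceded by the m_r + 1
   variables of each factor r < i; in the codomain X_l, B_p is number p and B is number l. *)
definition A_in :: "nat list \<Rightarrow> nat \<Rightarrow> nat \<Rightarrow> variable" where
  "A_in m i j = Inl ((\<Sum>r<i. m ! r + 1) + j)"

definition A_out :: "nat list \<Rightarrow> nat \<Rightarrow> variable" where
  "A_out m i = Inl ((\<Sum>r<i. m ! r + 1) + m ! i)"

definition B_in :: "nat \<Rightarrow> variable" where "B_in p = Inr p"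

definition B_out :: "nat \<Rightarrow> variable" where "B_out l = Inr l"

(* f is the morphism xi_T *)
fun represents :: "nat list \<Rightarrow> nat \<Rightarrow> graph \<Rightarrow> tree \<Rightarrow> bool" where
  "represents m l f (T, \<rho>, \<tau>) \<longleftrightarrow>
     K1_graph (X_tensor m) (X l) f \<and>
     (\<forall>a\<in>nodes T. \<forall>j<inputs T a. \<forall>b\<in>nodes T.
        b = a @ [j] \<longrightarrow> (A_in m (\<tau> a) j, A_out m (\<tau> b)) \<in> f) \<and>
     (\<forall>a\<in>nodes T. \<forall>j<inputs T a. \<forall>q<length (leaves T).
        leaves T ! q = a @ [j] \<longrightarrow> (A_in m (\<tau> a) j, B_in (\<rho> q)) \<in> f) \<and>
     (\<forall>a\<in>nodes T. a = [] \<longrightarrow> (A_out m (\<tau> a), B_out l) \<in> f) \<and>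
     (T = Null \<longrightarrow> (B_in 0, B_out l) \<in> f)"

end

theory Submission
  imports Defs "HOL-Library.Set_Algebras"
begin

text \<open>
  Every edge of a tree has two ends among the variables of \<open>X\<^bsub>m\<^sub>1\<^esub> \<otimes> \<dots> \<otimes> X\<^bsub>m\<^sub>k\<^esub> \<rightarrow> X\<^sub>l\<close>:
  the end at which it starts is \<open>A\<^sub>r\<close>, if it is the output of \<open>N\<^sub>r\<close>, or \<open>B\<^sub>p\<close>, if it is the
  \<open>p\<close>-th leaf; the end at which it arrives is some \<open>A\<^bsub>ij\<^esub>\<close>, or \<open>B\<close> for the root edge.  The starting
  ends are the negative variables and the arriving ends the positive ones, so if each variable is
  labelled by its edge, every label occurs once with either sign.  Hence \<open>\<xi>\<^sub>T\<close> is the graph that joins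
  the variables with equal labels, and it is the only graph with the required mates
  (\<open>represents_iff\<close>).

  Labels also give its allowability without the computation of any composite graph.  Say that one
  labelled context entails another if some allowable graph between them joins only variables with
  equal labels.  This relation is transitive, monotone, stable under permutation, and admits
  evaluation and currying.  By induction on the tree, its nodes \<open>[\<Otimes>\<^sub>j A\<^bsub>ij\<^esub>, A\<^sub>i]\<close> and its leaves
  together entail its root, one evaluation being used for each node; currying the leaves yields an
  allowable graph that joins only variables with equal labels (\<open>tree_derivation\<close>).  As each label
  occurs just twice, that graph is \<open>\<xi>\<^sub>T\<close>.

  Conversely, in a graph \<open>f\<close> the mate of \<open>A\<^sub>r\<close> is either \<open>B\<close> or an input of some node, the parent of
  \<open>N\<^sub>r\<close>.  The graph comes from a tree as soon as every node reaches \<open>B\<close> through its successive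
  parents: the paths are the addresses of the nodes, and a planar tree is the same thing as a finite
  prefix-closed set of addresses with a number of inputs at each (\<open>ptree_of_addresses\<close>).  What must be excluded is a set of nodes
  whose parents run in a cycle.  No analysis of derivations is needed for this, since a model of the
  closed structure suffices.  Interpret shapes as subsets of a commutative monoid, with sums of sets
  for the tensor product and residuals for the internal hom.  An allowable \<open>f: T \<rightarrow> S\<close> yields an
  inclusion of the value of \<open>T\<close> in that of \<open>S\<close>, whatever subsets are assigned to the variables,
  provided that mates receive the same subset (\<open>phase_sound\<close>).  Over the natural numbers, assign the
  whole monoid to the outputs of the nodes that do not reach \<open>B\<close> and to their mates, and \<open>{0}\<close> to all
  other variables.  If there is such a node, the domain takes the value \<open>\<nat>\<close> and the codomain the value
  \<open>{0}\<close>, a contradiction (\<open>all_located\<close>).  Finally the addresses are determined by \<open>f\<close>, and so is the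
  tree (\<open>represented_tree_unique\<close>).
\<close>

section \<open>Sign-reversing matchings\<close>

text \<open>Being a graph depends on the shapes only through a set of signed points.  Stated at this
  level, tensor, hom and composition become a disjoint union, a relabelling and a gluing.\<close>

definition matching :: "'a set \<Rightarrow> ('a \<Rightarrow> bool) \<Rightarrow> ('a \<times> 'a) set \<Rightarrow> bool" where
  "matching V s f \<longleftrightarrow>
     f \<subseteq> V \<times> V \<and> sym f \<and> (\<forall>x\<in>V. \<exists>!y. (x, y) \<in> f) \<and> (\<forall>(x, y)\<in>f. s x \<noteq> s y)"

lemma K1_graph_matching: "K1_graph T S f \<longleftrightarrow> matching (vars T S) (variance T S) f"
  unfolding K1_graph_def matching_def irrefl_def by fastforce

lemma matching_unique: "matching V s f \<Longrightarrow> (x, y) \<in> f \<Longrightarrow> (x, z) \<in> f \<Longrightarrow> y = z"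
  unfolding matching_def by blast

lemma matching_sym: "matching V s f \<Longrightarrow> (x, y) \<in> f \<Longrightarrow> (y, x) \<in> f"
  unfolding matching_def by (blast dest: symD)

lemma matching_sign: "matching V s f \<Longrightarrow> (x, y) \<in> f \<Longrightarrow> s x \<longleftrightarrow> \<not> s y"
  unfolding matching_def by blast

lemma matching_in: "matching V s f \<Longrightarrow> (x, y) \<in> f \<Longrightarrow> x \<in> V \<and> y \<in> V"
  unfolding matching_def by blast

lemma matching_ex: "matching V s f \<Longrightarrow> x \<in> V \<Longrightarrow> \<exists>y. (x, y) \<in> f"
  unfolding matching_def by blast

lemma matchingI:
  assumes "\<And>x y. (x, y) \<in> f \<Longrightarrow> x \<in> V \<and> (y, x) \<in> f \<and> (s x \<longleftrightarrow> \<not> s y)"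
    and "\<And>x. x \<in> V \<Longrightarrow> \<exists>y. (x, y) \<in> f"
    and "\<And>x y z. (x, y) \<in> f \<Longrightarrow> (x, z) \<in> f \<Longrightarrow> y = z"
  shows "matching V s f"
  unfolding matching_def
proof (intro conjI ballI)
  show "f \<subseteq> V \<times> V" using assms(1) by auto
  show "sym f" unfolding sym_def using assms(1) by auto
  show "\<exists>!y. (x, y) \<in> f" if "x \<in> V" for x using assms(2)[OF that] assms(3) by blast
  show "case e of (x, y) \<Rightarrow> s x \<noteq> s y" if "e \<in> f" for e using that assms(1) by auto
qed

lemma matching_subset_eq:
  assumes "matching V s f" "matching V s' g" "f \<subseteq> g"
  shows "f = g"
proof
  show "g \<subseteq> f"
  proof
    fix e assume e: "e \<in> g"
    obtain x y where xy: "e = (x, y)" by (cases e)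
    then have "x \<in> V" using e matching_in[OF assms(2)] by auto
    then obtain z where "(x, z) \<in> f" using matching_ex[OF assms(1)] by blast
    then show "e \<in> f" using e xy assms(3) matching_unique[OF assms(2)] by blast
  qed
qed (fact assms(3))

lemma matching_Un:
  assumes "matching V s f" "matching W s g" "V \<inter> W = {}"
  shows "matching (V \<union> W) s (f \<union> g)"
proof (rule matchingI)
  fix x y z assume "(x, y) \<in> f \<union> g" "(x, z) \<in> f \<union> g"
  then show "y = z"
    using assms(3) matching_unique[OF assms(1)] matching_unique[OF assms(2)]
      matching_in[OF assms(1)] matching_in[OF assms(2)] by blast
qed (use assms in \<open>auto dest: matching_sym matching_sign matching_in matching_ex\<close>)

lemma matching_image:
  assumes "matching V s f" "inj_on r V" "\<And>x. x \<in> V \<Longrightarrow> s' (r x) = s x"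
  shows "matching (r ` V) s' (map_prod r r ` f)"
proof (rule matchingI)
  fix x y assume "(x, y) \<in> map_prod r r ` f"
  then obtain a b where ab: "(a, b) \<in> f" "x = r a" "y = r b" by auto
  then show "x \<in> r ` V \<and> (y, x) \<in> map_prod r r ` f \<and> (s' x \<longleftrightarrow> \<not> s' y)"
    using matching_sym[OF assms(1) ab(1)] matching_sign[OF assms(1) ab(1)]
      matching_in[OF assms(1) ab(1)] assms(3) by (auto intro: rev_image_eqI)
next
  fix x assume "x \<in> r ` V"
  then show "\<exists>y. (x, y) \<in> map_prod r r ` f"
    using matching_ex[OF assms(1)] by (fastforce intro: rev_image_eqI)
next
  fix x y z assume "(x, y) \<in> map_prod r r ` f" "(x, z) \<in> map_prod r r ` f"
  then obtain a b c d where "(a, b) \<in> f" "x = r a" "y = r b" "(c, d) \<in> f" "x = r c" "z = r d"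
    by auto
  then show "y = z"
    using matching_in[OF assms(1)] matching_unique[OF assms(1)] inj_onD[OF assms(2)] by metis
qed

lemma matching_vimage:
  assumes "matching (r ` V) s f" "inj r"
  shows "matching V (s \<circ> r) {(x, y). (r x, r y) \<in> f}"
proof (rule matchingI)
  fix x assume "x \<in> V"
  then obtain z where "(r x, z) \<in> f" using matching_ex[OF assms(1)] by blast
  moreover from this have "z \<in> r ` V" using matching_in[OF assms(1)] by blast
  ultimately show "\<exists>y. (x, y) \<in> {(x, y). (r x, r y) \<in> f}" by auto
next
  fix x y z assume "(x, y) \<in> {(x, y). (r x, r y) \<in> f}" "(x, z) \<in> {(x, y). (r x, r y) \<in> f}"
  then show "y = z" using matching_unique[OF assms(1)] injD[OF assms(2)] by auto
next
  fix x y assume "(x, y) \<in> {(x, y). (r x, r y) \<in> f}"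
  then have "(r x, r y) \<in> f" by simp
  then show "x \<in> V \<and> (y, x) \<in> {(x, y). (r x, r y) \<in> f} \<and> ((s \<circ> r) x \<longleftrightarrow> \<not> (s \<circ> r) y)"
    using matching_in[OF assms(1)] matching_sym[OF assms(1)] matching_sign[OF assms(1)]
      injD[OF assms(2)] by fastforce
qed

lemma matching_join:
  assumes "Domain E \<union> Range E = V" "Domain E \<inter> Range E = {}"
    and "single_valued E" "single_valued (E\<inverse>)"
    and "\<And>x y. (x, y) \<in> E \<Longrightarrow> s x \<longleftrightarrow> \<not> s y"
  shows "matching V s (join E)"
proof (rule matchingI)
  fix x y z assume "(x, y) \<in> join E" "(x, z) \<in> join E"
  then show "y = z" using assms(2-4) unfolding join_def single_valued_def by blast
next
  fix x assume "x \<in> V"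
  then show "\<exists>y. (x, y) \<in> join E" using assms(1) unfolding join_def by blast
next
  fix x y assume "(x, y) \<in> join E"
  then show "x \<in> V \<and> (y, x) \<in> join E \<and> (s x \<longleftrightarrow> \<not> s y)"
    using assms(1,5) unfolding join_def by blast
qed

text \<open>A relation that is single-valued in both directions is a disjoint union of directed chains and
cycles, so an undirected path between two points can be straightened to a directed one.\<close>

lemma biunique_connected:
  assumes "single_valued D" "single_valued (D\<inverse>)" "(x, y) \<in> (D \<union> D\<inverse>)\<^sup>*"
  shows "(x, y) \<in> D\<^sup>* \<or> (y, x) \<in> D\<^sup>*"
  using assms(3)
proof (induction rule: rtrancl_induct)
  case (step y z)
  show ?case
  proof (cases "(y, z) \<in> D")
    case True
    from step.IH show ?thesis
    proof
      assume "(x, y) \<in> D\<^sup>*" then show ?thesis using True by (meson rtrancl.rtrancl_into_rtrancl)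
    next
      assume "(y, x) \<in> D\<^sup>*"
      then show ?thesis
      proof (cases rule: converse_rtranclE)
        case base then show ?thesis using True by auto
      next
        case (step u) then show ?thesis using True assms(1) by (metis single_valuedD)
      qed
    qed
  next
    case False
    then have zy: "(z, y) \<in> D" using step.hyps(2) by blast
    from step.IH show ?thesis
    proof
      assume "(y, x) \<in> D\<^sup>*" then show ?thesis using zy by (meson converse_rtrancl_into_rtrancl)
    next
      assume "(x, y) \<in> D\<^sup>*"
      then show ?thesis
      proof (cases rule: rtranclE)
        case base then show ?thesis using zy by auto
      next
        case (step u) then show ?thesis using zy assms(2) by (metis converse_iff single_valuedD)
      qed
    qed
  qed
qed auto

text \<open>Otherwise every point reachable from \<open>x\<close> has a successor.  The successor map is then injective on
the finite set of these points, hence onto, and \<open>x\<close> would be a successor.\<close>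

lemma source_reaches_sink:
  assumes "finite D" "single_valued D" "single_valued (D\<inverse>)" "x \<notin> Range D"
  shows "\<exists>y. (x, y) \<in> D\<^sup>* \<and> y \<notin> Domain D"
proof (rule ccontr)
  assume "\<not> ?thesis"
  then have ex: "\<forall>y\<in>D\<^sup>* `` {x}. \<exists>z. (y, z) \<in> D" by blast
  define succ where "succ y = (SOME z. (y, z) \<in> D)" for y
  have nx: "(y, succ y) \<in> D" if "y \<in> D\<^sup>* `` {x}" for y
    using ex that unfolding succ_def by (meson someI_ex)
  have "D\<^sup>* `` {x} \<subseteq> insert x (Range D)"
    by (auto elim: rtranclE)
  then have fin: "finite (D\<^sup>* `` {x})"
    using assms(1) finite_subset by (metis finite_Range finite_insert)
  have "succ ` (D\<^sup>* `` {x}) \<subseteq> D\<^sup>* `` {x}"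
    using nx by (fastforce intro: rtrancl_into_rtrancl)
  moreover have "inj_on succ (D\<^sup>* `` {x})"
  proof (rule inj_onI)
    fix a b assume "a \<in> D\<^sup>* `` {x}" "b \<in> D\<^sup>* `` {x}" "succ a = succ b"
    then show "a = b" using nx[of a] nx[of b] assms(3) by (metis converseI single_valuedD)
  qed
  ultimately have "succ ` (D\<^sup>* `` {x}) = D\<^sup>* `` {x}" using fin by (simp add: endo_inj_surj)
  then have "x \<in> succ ` (D\<^sup>* `` {x})" by blast
  then obtain y where "y \<in> D\<^sup>* `` {x}" "x = succ y" by blast
  then show False using nx assms(4) by blast
qed

lemma biunique_sinks_eq:
  assumes "single_valued D" "(x, y) \<in> D\<^sup>*" "(x, z) \<in> D\<^sup>*" "y \<notin> Domain D" "z \<notin> Domain D"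
  shows "y = z"
  using single_valued_confluent[OF assms(1-3)] assms(4,5)
  by (metis Domain.DomainI converse_rtranclE)

text \<open>A point of \<open>U\<close> has opposite signs in the two matchings.  Directing every edge from its negative to
its positive end therefore makes each point of \<open>U\<close> the end of one edge and the start of one edge,
each negative outer point a source and each positive one a sink.  The glued graph thus splits into
directed chains and cycles, and every source is joined to exactly one sink.\<close>

lemma matching_glue:
  assumes F: "matching (V \<union> U) s f" and G: "matching (U \<union> W) t g"
    and fin: "finite V" "finite U" "finite W"
    and disj: "V \<inter> U = {}" "V \<inter> W = {}" "U \<inter> W = {}"
    and flip: "\<And>u. u \<in> U \<Longrightarrow> s u \<longleftrightarrow> \<not> t u"
    and outer: "\<And>x. x \<in> V \<Longrightarrow> sg x = s x" "\<And>x. x \<in> W \<Longrightarrow> sg x = t x"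
  shows "matching (V \<union> W) sg
    {(x, y). x \<in> V \<union> W \<and> y \<in> V \<union> W \<and> x \<noteq> y \<and> (x, y) \<in> (f \<union> g)\<^sup>+}"
    (is "matching _ _ ?H")
proof -
  define D where "D = {(x, y) \<in> f. s y} \<union> {(x, y) \<in> g. t y}"
  have Df: "(x, y) \<in> D \<longleftrightarrow> (x, y) \<in> f \<and> \<not> s x \<and> s y \<or> (x, y) \<in> g \<and> \<not> t x \<and> t y" for x y
    unfolding D_def using matching_sign[OF F] matching_sign[OF G] by blast
  have fg: "f \<union> g = D \<union> D\<inverse>"
    using matching_sign[OF F] matching_sign[OF G] matching_sym[OF F] matching_sym[OF G]
    by (auto simp: Df)
  note inF = matching_in[OF F] and inG = matching_in[OF G]
  have cases: thesis
    if "(x, y) \<in> D" "(x, y) \<in> f \<Longrightarrow> \<not> s x \<Longrightarrow> s y \<Longrightarrow> x \<in> V \<union> U \<Longrightarrow> y \<in> V \<union> U \<Longrightarrow> thesis"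
      "(x, y) \<in> g \<Longrightarrow> \<not> t x \<Longrightarrow> t y \<Longrightarrow> x \<in> U \<union> W \<Longrightarrow> y \<in> U \<union> W \<Longrightarrow> thesis" for x y thesis
    using that Df inF inG by metis
  have U: "x \<in> U" if "x \<in> V \<union> U" "x \<in> U \<union> W" for x using that disj by auto
  have sv: "single_valued D"
  proof (rule single_valuedI)
    fix x y z assume xy: "(x, y) \<in> D" and xz: "(x, z) \<in> D"
    show "y = z"
      by (rule cases[OF xy]; rule cases[OF xz])
        (metis U flip matching_unique[OF F] matching_unique[OF G])+
  qed
  have vs: "single_valued (D\<inverse>)"
  proof (rule single_valuedI)
    fix x y z assume "(x, y) \<in> D\<inverse>" "(x, z) \<in> D\<inverse>"
    then have yx: "(y, x) \<in> D" and zx: "(z, x) \<in> D" by auto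
    show "y = z"
      by (rule cases[OF yx]; rule cases[OF zx])
        (metis U flip matching_unique[OF F] matching_unique[OF G]
          matching_sym[OF F] matching_sym[OF G])+
  qed
  have finD: "finite D"
  proof (rule finite_subset)
    show "D \<subseteq> (V \<union> U \<union> W) \<times> (V \<union> U \<union> W)" using inF inG unfolding D_def by blast
  qed (use fin in auto)
  have outgoing: "\<exists>y. (x, y) \<in> D" if "x \<in> V \<union> U \<and> \<not> s x \<or> x \<in> U \<union> W \<and> \<not> t x" for x
    using that matching_ex[OF F] matching_ex[OF G] matching_sign[OF F] matching_sign[OF G] Df
    by metis
  have incoming: "\<exists>y. (y, x) \<in> D" if "x \<in> V \<union> U \<and> s x \<or> x \<in> U \<union> W \<and> t x" for x
    using that matching_ex[OF F] matching_ex[OF G] matching_sign[OF F] matching_sign[OF G]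
      matching_sym[OF F] matching_sym[OF G] Df by metis
  have dom: "x \<in> Domain D \<longleftrightarrow> \<not> sg x" "x \<in> Range D \<longleftrightarrow> sg x" if x: "x \<in> V \<union> W" for x
  proof -
    have xU: "x \<notin> U" using x disj by blast
    have out: "\<not> sg x" if "(x, y) \<in> D" for y
      by (rule cases[OF that]) (use x xU disj outer in auto)
    have inc: "sg x" if "(y, x) \<in> D" for y
      by (rule cases[OF that]) (use x xU disj outer in auto)
    show "x \<in> Domain D \<longleftrightarrow> \<not> sg x" "x \<in> Range D \<longleftrightarrow> sg x"
      using out inc outgoing[of x] incoming[of x] x outer by blast+
  qed
  have mid: "x \<in> Domain D" "x \<in> Range D" if x: "x \<in> U" for x
    using outgoing[of x] incoming[of x] x flip by blast+
  have field: "x \<in> V \<union> U \<union> W" if "x \<in> Domain D \<union> Range D" for x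
    using that inF inG unfolding D_def by blast
  have conn: "(f \<union> g)\<^sup>* = (D \<union> D\<inverse>)\<^sup>*" by (simp add: fg)
  have symfg: "sym ((f \<union> g)\<^sup>+)"
    by (rule sym_trancl) (use matching_sym[OF F] matching_sym[OF G] in \<open>auto intro: symI\<close>)
  have H: "(x, y) \<in> ?H \<longleftrightarrow> x \<in> V \<union> W \<and> y \<in> V \<union> W \<and> x \<noteq> y \<and> ((x, y) \<in> D\<^sup>* \<or> (y, x) \<in> D\<^sup>*)" for x y
  proof -
    have "(x, y) \<in> (D \<union> D\<inverse>)\<^sup>* \<longleftrightarrow> (x, y) \<in> D\<^sup>* \<or> (y, x) \<in> D\<^sup>*"
    proof
      assume "(x, y) \<in> D\<^sup>* \<or> (y, x) \<in> D\<^sup>*"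
      moreover have "D\<^sup>* \<subseteq> (D \<union> D\<inverse>)\<^sup>*" by (simp add: rtrancl_mono)
      moreover have "sym ((D \<union> D\<inverse>)\<^sup>*)" by (simp add: sym_Un_converse sym_rtrancl)
      ultimately show "(x, y) \<in> (D \<union> D\<inverse>)\<^sup>*" by (meson subsetD symD)
    qed (rule biunique_connected[OF sv vs])
    then show ?thesis by (auto simp: rtrancl_eq_or_trancl fg)
  qed
  have start: "a \<in> Domain D" if "(a, b) \<in> D\<^sup>*" "a \<noteq> b" for a b
    using that by (metis Domain.DomainI converse_rtranclE)
  have finish: "b \<in> Range D" if "(a, b) \<in> D\<^sup>*" "a \<noteq> b" for a b
    using that by (metis Range.RangeI rtranclE)
  show ?thesis
  proof (rule matchingI)
    fix x y assume "(x, y) \<in> ?H"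
    then show "x \<in> V \<union> W \<and> (y, x) \<in> ?H \<and> (sg x \<longleftrightarrow> \<not> sg y)"
      unfolding H using start finish dom by metis
  next
    fix x assume x: "x \<in> V \<union> W"
    show "\<exists>y. (x, y) \<in> ?H"
    proof (cases "sg x")
      case False
      obtain y where y: "(x, y) \<in> D\<^sup>*" "y \<notin> Domain D"
        using source_reaches_sink[OF finD sv vs] dom(2)[OF x] False by blast
      then have ne: "x \<noteq> y" using dom(1)[OF x] False by blast
      have "y \<in> V \<union> W" using field finish[OF y(1) ne] mid(1) y(2) by blast
      then show ?thesis unfolding H using x y ne by blast
    next
      case True
      obtain y where y: "(x, y) \<in> (D\<inverse>)\<^sup>*" "y \<notin> Domain (D\<inverse>)"
        using source_reaches_sink[of "D\<inverse>" x] finD sv vs dom(1)[OF x] True by auto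
      then have y': "(y, x) \<in> D\<^sup>*" "y \<notin> Range D" by (auto simp: rtrancl_converse)
      then have ne: "y \<noteq> x" using dom(2)[OF x] True by blast
      have "y \<in> V \<union> W" using field start[OF y'(1) ne] mid(2) y'(2) by blast
      then show ?thesis unfolding H using x y' ne by blast
    qed
  next
    fix x y z assume "(x, y) \<in> ?H" "(x, z) \<in> ?H"
    then have o: "x \<in> V \<union> W" "y \<in> V \<union> W" "z \<in> V \<union> W" "x \<noteq> y" "x \<noteq> z"
      and p: "(x, y) \<in> D\<^sup>* \<or> (y, x) \<in> D\<^sup>*" "(x, z) \<in> D\<^sup>* \<or> (z, x) \<in> D\<^sup>*" unfolding H by auto
    show "y = z"
    proof (cases "sg x")
      case False
      then have "(x, y) \<in> D\<^sup>*" "(x, z) \<in> D\<^sup>*" using p o finish dom(2)[OF o(1)] by blast+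
      then show ?thesis
        using biunique_sinks_eq[OF sv] finish o dom by metis
    next
      case True
      then have "(y, x) \<in> D\<^sup>*" "(z, x) \<in> D\<^sup>*" using p o start dom(1)[OF o(1)] by blast+
      then show ?thesis
        using biunique_sinks_eq[OF vs, of x y z] start o dom
        by (metis Domain_converse rtrancl_converseI)
    qed
  qed
qed

section \<open>Allowable morphisms are graphs\<close>

lemma ex_vars: "x \<in> vars T S \<longleftrightarrow> (\<exists>i<nv T. x = Inl i) \<or> (\<exists>j<nv S. x = Inr j)"
  by (auto simp: vars_def)

lemma K1_id: "K1_graph T T (id_graph T)"
  unfolding K1_graph_matching id_graph_def
  by (rule matching_join)
    (auto simp: ex_vars variance_def single_valued_def Domain_iff Range_iff set_eq_iff)

lemma less_add_cases: "i < k + n \<Longrightarrow> i < k \<or> (\<exists>j<n. i = k + (j::nat))"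
  by presburger

lemma K1_c: "K1_graph (T \<otimes>\<^sub>s S) (S \<otimes>\<^sub>s T) (c_graph T S)"
  unfolding K1_graph_matching c_graph_def
  by (rule matching_join)
    (auto simp: ex_vars variance_def single_valued_def Domain_iff Range_iff set_eq_iff v_tensor
      nth_append dest!: less_add_cases)

lemma K1_d: "K1_graph T \<lblot>S, T \<otimes>\<^sub>s S\<rblot> (d_graph T S)"
  unfolding K1_graph_matching d_graph_def
  by (rule matching_join)
    (auto simp: ex_vars variance_def single_valued_def Domain_iff Range_iff set_eq_iff v_tensor
      v_ihom nth_append dest!: less_add_cases)

lemma v_Hom_Cons: "v (Hom T S # R) = op_signs (v T) @ v S @ v R"
  by (simp add: v_def)

lemma K1_e: "K1_graph (\<lblot>T, S\<rblot> \<otimes>\<^sub>s T) S (e_graph T S)"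
  unfolding K1_graph_matching e_graph_def
  by (rule matching_join)
    (auto simp: ex_vars variance_def single_valued_def Domain_iff Range_iff set_eq_iff v_Hom_Cons nth_append dest!: less_add_cases)

lemma matching_cong: "matching V s f \<Longrightarrow> (\<And>x. x \<in> V \<Longrightarrow> s' x = s x) \<Longrightarrow> matching V s' f"
  using matching_image[of V s f id s'] by (simp add: prod.map_id0)

lemma K1_tensor:
  assumes "K1_graph T T' f" "K1_graph S S' g"
  shows "K1_graph (T \<otimes>\<^sub>s S) (T' \<otimes>\<^sub>s S') (tensor_graph T T' f g)"
proof -
  let ?s = "variance (T \<otimes>\<^sub>s S) (T' \<otimes>\<^sub>s S')"
  let ?r = "map_sum ((+) (nv T)) ((+) (nv T'))"
  have "matching (vars T T') ?s f"
    by (rule matching_cong[OF assms(1)[unfolded K1_graph_matching]])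
      (auto simp: ex_vars variance_def v_tensor nth_append)
  moreover have "matching (?r ` vars S S') ?s (map_prod ?r ?r ` g)"
    by (rule matching_image[OF assms(2)[unfolded K1_graph_matching]])
      (auto simp: ex_vars variance_def v_tensor nth_append intro!: inj_onI)
  moreover have "vars (T \<otimes>\<^sub>s S) (T' \<otimes>\<^sub>s S') = vars T T' \<union> ?r ` vars S S'"
    by (force simp: ex_vars v_tensor dest!: less_add_cases)
  moreover have "vars T T' \<inter> ?r ` vars S S' = {}"
    by (auto simp: ex_vars)
  ultimately show ?thesis
    unfolding K1_graph_matching tensor_graph_def Let_def by (metis matching_Un)
qed

lemma K1_hom:
  assumes "K1_graph T T' f" "K1_graph S S' g"
  shows "K1_graph \<lblot>T', S\<rblot> \<lblot>T, S'\<rblot> (hom_graph T T' f g)"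
proof -
  let ?s = "variance \<lblot>T', S\<rblot> \<lblot>T, S'\<rblot>"
  let ?q = "case_sum Inr Inl :: variable \<Rightarrow> variable"
  let ?r = "map_sum ((+) (nv T')) ((+) (nv T))"
  have "matching (?q ` vars T T') ?s (map_prod ?q ?q ` f)"
    by (rule matching_image[OF assms(1)[unfolded K1_graph_matching]])
      (auto simp: ex_vars variance_def v_ihom nth_append intro!: inj_onI)
  moreover have "matching (?r ` vars S S') ?s (map_prod ?r ?r ` g)"
    by (rule matching_image[OF assms(2)[unfolded K1_graph_matching]])
      (auto simp: ex_vars variance_def v_ihom nth_append intro!: inj_onI)
  moreover have "vars \<lblot>T', S\<rblot> \<lblot>T, S'\<rblot> = ?q ` vars T T' \<union> ?r ` vars S S'"
    by (force simp: ex_vars v_ihom image_iff dest!: less_add_cases)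
  moreover have "?q ` vars T T' \<inter> ?r ` vars S S' = {}"
    by (auto simp: ex_vars)
  ultimately show ?thesis
    unfolding K1_graph_matching hom_graph_def Let_def by (metis matching_Un)
qed

text \<open>The datatype of glued variables distinguishes the three shapes, so each of the two graphs becomes a
matching with its own signs; the middle variables have opposite variances in domain and codomain.\<close>

lemma K1_comp:
  assumes "K1_graph T S f" "K1_graph S R g"
  shows "K1_graph T R (comp_graph g f)"
proof -
  let ?F = "map_prod (case_sum Dom Mid) (case_sum Dom Mid) ` f"
  let ?G = "map_prod (case_sum Mid Cod) (case_sum Mid Cod) ` g"
  let ?outer = "case_sum Dom Cod :: variable \<Rightarrow> glued"
  let ?V = "Dom ` {..<nv T}" and ?U = "Mid ` {..<nv S}" and ?W = "Cod ` {..<nv R}"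
  define s where "s = case_glued (\<lambda>i. variance T S (Inl i)) (\<lambda>j. variance T S (Inr j)) (\<lambda>j. False)"
  define t where "t = case_glued (\<lambda>i. False) (\<lambda>i. variance S R (Inl i)) (\<lambda>j. variance S R (Inr j))"
  define sign where "sign = case_glued (\<lambda>i. variance T R (Inl i)) (\<lambda>j. False) (\<lambda>j. variance T R (Inr j))"
  have "case_sum Dom Mid ` vars T S = ?V \<union> ?U" "case_sum Mid Cod ` vars S R = ?U \<union> ?W"
    by (force simp: ex_vars)+
  moreover have "matching (case_sum Dom Mid ` vars T S) s ?F"
    by (rule matching_image[OF assms(1)[unfolded K1_graph_matching]])
      (auto simp: ex_vars s_def intro!: inj_onI)
  moreover have "matching (case_sum Mid Cod ` vars S R) t ?G"
    by (rule matching_image[OF assms(2)[unfolded K1_graph_matching]])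
      (auto simp: ex_vars t_def intro!: inj_onI)
  ultimately have F: "matching (?V \<union> ?U) s ?F" and G: "matching (?U \<union> ?W) t ?G" by simp_all
  let ?H = "{(x, y). x \<in> ?V \<union> ?W \<and> y \<in> ?V \<union> ?W \<and> x \<noteq> y \<and> (x, y) \<in> (?F \<union> ?G)\<^sup>+}"
  have "matching (?V \<union> ?W) sign ?H"
    by (rule matching_glue[OF F G]) (auto simp: s_def t_def sign_def variance_def)
  moreover have "?outer ` vars T R = ?V \<union> ?W" by (force simp: ex_vars)
  ultimately have "matching (?outer ` vars T R) sign ?H" by simp
  then have "matching (vars T R) (sign \<circ> ?outer) {(x, y). (?outer x, ?outer y) \<in> ?H}"
    by (rule matching_vimage) (auto simp: inj_def split: sum.splits)
  moreover have "sign \<circ> ?outer = variance T R"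
    by (auto simp: sign_def fun_eq_iff split: sum.splits)
  moreover have "{(x, y). (?outer x, ?outer y) \<in> ?H} = comp_graph g f"
  proof -
    have "?F \<union> ?G \<subseteq> (?V \<union> ?U \<union> ?W) \<times> (?V \<union> ?U \<union> ?W)"
    proof (rule subsetI)
      fix e assume e: "e \<in> ?F \<union> ?G"
      obtain a b where "e = (a, b)" by (cases e)
      then show "e \<in> (?V \<union> ?U \<union> ?W) \<times> (?V \<union> ?U \<union> ?W)"
        using e matching_in[OF F, of a b] matching_in[OF G, of a b] by blast
    qed
    then have sub: "(?F \<union> ?G)\<^sup>+ \<subseteq> (?V \<union> ?U \<union> ?W) \<times> (?V \<union> ?U \<union> ?W)"
      by (rule trancl_subset_Sigma)
    have no: "?outer x \<notin> ?U" for x by (cases x) auto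
    have inj: "?outer x = ?outer y \<longleftrightarrow> x = y" for x y by (auto split: sum.splits)
    have "?outer x \<in> ?V \<union> ?W \<and> ?outer y \<in> ?V \<union> ?W" if "(?outer x, ?outer y) \<in> (?F \<union> ?G)\<^sup>+" for x y
      using subsetD[OF sub that] no[of x] no[of y] by blast
    then show ?thesis unfolding comp_graph_def Let_def using inj by auto
  qed
  ultimately show ?thesis unfolding K1_graph_matching by simp
qed

theorem allowable_K1: "allowable T S f \<Longrightarrow> K1_graph T S f"
  by (induction rule: allowable.induct)
    (rule K1_id K1_c K1_d K1_e K1_tensor K1_hom K1_comp; assumption)+

section \<open>Labellings constant on mates\<close>

definition compatible :: "graph \<Rightarrow> (nat \<Rightarrow> 'a) \<Rightarrow> (nat \<Rightarrow> 'a) \<Rightarrow> bool" where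
  "compatible f x y \<longleftrightarrow> (\<forall>(u, w)\<in>f. case_sum x y u = case_sum x y w)"

lemma compatible_join: "compatible (join E) x y \<longleftrightarrow> (\<forall>(u, w)\<in>E. case_sum x y u = case_sum x y w)"
  unfolding compatible_def join_def by fastforce

lemma ball_image_Collect: "(\<forall>e\<in>{h i |i. P i}. Q e) \<longleftrightarrow> (\<forall>i. P i \<longrightarrow> Q (h i))"
  by auto

lemma compatible_id: "compatible (id_graph T) x y \<longleftrightarrow> (\<forall>i<nv T. x i = y i)"
  unfolding id_graph_def compatible_join ball_Un ball_image_Collect by simp

lemma compatible_c: "compatible (c_graph T S) x y \<longleftrightarrow>
    (\<forall>i<nv T. x i = y (nv S + i)) \<and> (\<forall>j<nv S. x (nv T + j) = y j)"
  unfolding c_graph_def compatible_join ball_Un ball_image_Collect by simp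

lemma compatible_d: "compatible (d_graph T S) x y \<longleftrightarrow>
    (\<forall>i<nv T. x i = y (nv S + i)) \<and> (\<forall>j<nv S. y j = y (nv S + nv T + j))"
  unfolding d_graph_def compatible_join ball_Un ball_image_Collect by simp

lemma compatible_e: "compatible (e_graph T S) x y \<longleftrightarrow>
    (\<forall>i<nv T. x i = x (nv T + nv S + i)) \<and> (\<forall>j<nv S. x (nv T + j) = y j)"
  unfolding e_graph_def compatible_join ball_Un ball_image_Collect by simp

lemma ball_map_prod:
  "(\<forall>(u, w)\<in>map_prod r r ` f. L u = L w) \<longleftrightarrow> (\<forall>(u, w)\<in>f. L (r u) = L (r w))"
  by (simp add: case_prod_unfold)

lemma compatible_tensor: "compatible (tensor_graph T T' f g) x y \<longleftrightarrow>
    compatible f x y \<and> compatible g (\<lambda>i. x (nv T + i)) (\<lambda>j. y (nv T' + j))"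
proof -
  have "case_sum x y (map_sum ((+) (nv T)) ((+) (nv T')) u) =
      case_sum (\<lambda>i. x (nv T + i)) (\<lambda>j. y (nv T' + j)) u" for u
    by (cases u) auto
  then show ?thesis by (simp only: compatible_def tensor_graph_def Let_def ball_Un ball_map_prod)
qed

lemma compatible_hom: "compatible (hom_graph T T' f g) x y \<longleftrightarrow>
    compatible f y x \<and> compatible g (\<lambda>i. x (nv T' + i)) (\<lambda>j. y (nv T + j))"
proof -
  have "case_sum x y (map_sum ((+) (nv T')) ((+) (nv T)) u) =
      case_sum (\<lambda>i. x (nv T' + i)) (\<lambda>j. y (nv T + j)) u" for u
    by (cases u) auto
  moreover have "case_sum x y (case_sum Inr Inl u) = case_sum y x u" for u
    by (cases u) auto
  ultimately show ?thesis by (simp only: compatible_def hom_graph_def Let_def ball_Un ball_map_prod)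
qed

text \<open>Labels of the outer variables that agree on mates of the composite spread along the glued paths to
the middle variables; those on discarded loops may be labelled arbitrarily.\<close>

lemma compatible_comp:
  assumes "sym f" "sym g"
  shows "compatible (comp_graph g f) x z \<longleftrightarrow> (\<exists>y. compatible f x y \<and> compatible g y z)"
proof -
  let ?F = "map_prod (case_sum Dom Mid) (case_sum Dom Mid) ` f"
  let ?G = "map_prod (case_sum Mid Cod) (case_sum Mid Cod) ` g"
  let ?outer = "case_sum Dom Cod :: variable \<Rightarrow> glued"
  let ?C = "(?F \<union> ?G)\<^sup>+"
  show ?thesis
  proof
    assume "\<exists>y. compatible f x y \<and> compatible g y z"
    then obtain y where y: "compatible f x y" "compatible g y z" by blast
    have lab: "case_glued x y z (case_sum Dom Mid u) = case_sum x y u"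
      "case_glued x y z (case_sum Mid Cod u) = case_sum y z u"
      "case_glued x y z (?outer u) = case_sum x z u" for u
      by (auto split: sum.splits)
    have edge: "case_glued x y z a = case_glued x y z b" if "(a, b) \<in> ?F \<union> ?G" for a b
      using that y unfolding compatible_def by (auto simp: lab)
    have "case_glued x y z a = case_glued x y z b" if "(a, b) \<in> ?C" for a b
      using that
    proof (induction rule: trancl_induct)
      case (base b) then show ?case by (rule edge)
    next
      case (step b c) then show ?case using edge[OF step.hyps(2)] by simp
    qed
    from this[of "?outer u" "?outer w" for u w] show "compatible (comp_graph g f) x z"
      unfolding compatible_def comp_graph_def Let_def lab by auto
  next
    assume r: "compatible (comp_graph g f) x z"
    let ?E = "(?F \<union> ?G)\<^sup>*"
    have symE: "sym ?E"
      using assms by (intro sym_rtrancl) (auto simp: sym_def intro: rev_image_eqI)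
    have outer: "case_sum x z u = case_sum x z w" if "(?outer u, ?outer w) \<in> ?E" for u w
    proof (cases "u = w")
      case False
      then have "?outer u \<noteq> ?outer w" by (auto split: sum.splits)
      then have "(u, w) \<in> comp_graph g f"
        using that False by (simp add: comp_graph_def Let_def rtrancl_eq_or_trancl)
      then show ?thesis using r unfolding compatible_def by auto
    qed simp
    \<comment> \<open>The label of any outer variable in the same component; on a loop this is an arbitrary value.\<close>
    define col where "col a = case_sum x z (SOME u. (?outer u, a) \<in> ?E)" for a
    have const: "col a = col b" if "(a, b) \<in> ?F \<union> ?G" for a b
    proof -
      have "(a, b) \<in> ?E" using that by blast
      then have "(?outer u, a) \<in> ?E \<longleftrightarrow> (?outer u, b) \<in> ?E" for u
        using symE by (meson symD rtrancl_trans)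
      then show ?thesis unfolding col_def by simp
    qed
    have col: "col (?outer u) = case_sum x z u" for u
      unfolding col_def by (rule outer, rule someI) (rule rtrancl.rtrancl_refl)
    define y where "y j = col (Mid j)" for j
    have f: "case_sum x y u = col (case_sum Dom Mid u)" for u
      using col[of u] by (cases u) (simp_all add: y_def)
    have g: "case_sum y z u = col (case_sum Mid Cod u)" for u
      using col[of u] by (cases u) (simp_all add: y_def)
    have "compatible f x y"
      unfolding compatible_def f by (auto intro!: const)
    moreover have "compatible g y z"
      unfolding compatible_def g by (auto intro!: const)
    ultimately show "\<exists>y. compatible f x y \<and> compatible g y z" by blast
  qed
qed

section \<open>Phase semantics\<close>

text \<open>The residual of the sum of sets.  With it the subsets of a commutative monoid form a symmetric
monoidal closed preorder: the phase semantics of intuitionistic linear logic, with every subset as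
a fact.\<close>

definition residual :: "'a::plus set \<Rightarrow> 'a set \<Rightarrow> 'a set" where
  "residual A B = {c. \<forall>a\<in>A. a + c \<in> B}"

lemma residual_mono: "A' \<subseteq> A \<Longrightarrow> B \<subseteq> B' \<Longrightarrow> residual A B \<subseteq> residual A' B'"
  unfolding residual_def by blast

lemma subset_residual: "C \<subseteq> residual A (C + A)" for A C :: "'a::ab_semigroup_add set"
proof
  fix c assume "c \<in> C"
  then have "a + c \<in> C + A" if "a \<in> A" for a
    using set_plus_intro[of c C a A] that by (simp only: add.commute[of a c])
  then show "c \<in> residual A (C + A)" unfolding residual_def by blast
qed

lemma residual_plus: "residual A B + A \<subseteq> B" for A B :: "'a::ab_semigroup_add set"
proof
  fix b assume "b \<in> residual A B + A"
  then obtain c a where "b = c + a" "c \<in> residual A B" "a \<in> A" by (elim set_plus_elim)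
  then show "b \<in> B" unfolding residual_def by (simp only: add.commute[of c a]) blast
qed

fun phase :: "shape \<Rightarrow> (nat \<Rightarrow> 'a::comm_monoid_add set) \<Rightarrow> 'a set"
  and phase_prime :: "prime_shape \<Rightarrow> (nat \<Rightarrow> 'a set) \<Rightarrow> 'a set" where
  "phase [] x = 0"
| "phase (p # T) x = phase_prime p x + phase T (\<lambda>i. x (nv [p] + i))"
| "phase_prime One x = x 0"
| "phase_prime (Hom T S) x = residual (phase T x) (phase S (\<lambda>i. x (nv T + i)))"

lemma phase_tensor: "phase (T \<otimes>\<^sub>s S) x = phase T x + phase S (\<lambda>i. x (nv T + i))"
  by (induction T arbitrary: x) (simp_all add: v_def add.assoc)

lemma phase_cong:
  "(\<And>i. i < nv T \<Longrightarrow> x i = y i) \<Longrightarrow> phase T x = phase T y"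
  "(\<And>i. i < nv [p] \<Longrightarrow> x i = y i) \<Longrightarrow> phase_prime p x = phase_prime p y"
proof (induction T x and p x arbitrary: y and y rule: phase_phase_prime.induct)
  case (2 p T x)
  have "phase_prime p x = phase_prime p y"
    using "2.prems" by (intro "2.IH"(1)) (simp add: v_def)
  moreover have "phase T (\<lambda>i. x (nv [p] + i)) = phase T (\<lambda>i. y (nv [p] + i))"
    using "2.prems" by (intro "2.IH"(2)) (simp add: v_def)
  ultimately show ?case by simp
next
  case (4 T S x)
  have "phase T x = phase T y"
    using "4.prems" by (intro "4.IH"(1)) (simp add: v_def)
  moreover have "phase S (\<lambda>i. x (nv T + i)) = phase S (\<lambda>i. y (nv T + i))"
    using "4.prems" by (intro "4.IH"(2)) (simp add: v_def)
  ultimately show ?case by simp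
qed (simp_all add: v_def)

text \<open>The structural morphisms \<open>c\<close>, \<open>d\<close>, \<open>e\<close> express commutativity of the sum and the adjunction between
sum and residual, and composition is transitivity of inclusion.  The independent labels of distinct
pairs of mates make this a statement about the graph, and not only about its two shapes.\<close>

theorem phase_sound:
  "allowable T S f \<Longrightarrow> compatible f x y \<Longrightarrow> phase T x \<subseteq> phase S y"
proof (induction arbitrary: x y rule: allowable.induct)
  case (allowable_id T)
  then show ?case using phase_cong(1)[of T x y] by (simp add: compatible_id)
next
  case (allowable_c T S)
  then have "phase T x = phase T (\<lambda>i. y (nv S + i))" "phase S (\<lambda>i. x (nv T + i)) = phase S y"
    by (auto simp: compatible_c intro!: phase_cong(1))
  then show ?case by (simp add: phase_tensor add.commute)
next
  case (allowable_d T S)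
  then have "phase T x = phase T (\<lambda>i. y (nv S + i))"
    "phase S y = phase S (\<lambda>i. y (nv S + (nv T + i)))"
    by (auto simp: compatible_d add.assoc intro!: phase_cong(1))
  then show ?case by (simp add: phase_tensor subset_residual)
next
  case (allowable_e T S)
  then have "phase T x = phase T (\<lambda>i. x (nv T + nv S + i))"
    "phase S (\<lambda>i. x (nv T + i)) = phase S y"
    by (auto simp: compatible_e intro!: phase_cong(1))
  then show ?case by (simp add: phase_tensor v_ihom residual_plus)
next
  case (allowable_tensor T T' f S S' g)
  then show ?case by (simp add: compatible_tensor phase_tensor set_plus_mono2)
next
  case (allowable_hom T T' f S S' g)
  have "phase T y \<subseteq> phase T' x"
    "phase S (\<lambda>i. x (nv T' + i)) \<subseteq> phase S' (\<lambda>i. y (nv T + i))"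
    using allowable_hom.prems allowable_hom.IH unfolding compatible_hom by blast+
  then show ?case by (simp add: residual_mono)
next
  case (allowable_comp T S f R g)
  have "sym f" "sym g" using allowable_comp.hyps allowable_K1 unfolding K1_graph_def by auto
  then obtain z where "compatible f x z" "compatible g z y"
    using allowable_comp.prems compatible_comp by blast
  then show ?case using allowable_comp.IH by (meson subset_trans)
qed

section \<open>Derivations from labelled shapes\<close>

lemma compatible_cong:
  assumes "K1_graph T S f" "\<And>i. i < nv T \<Longrightarrow> x i = x' i" "\<And>j. j < nv S \<Longrightarrow> y j = y' j"
  shows "compatible f x y \<longleftrightarrow> compatible f x' y'"
proof -
  have "case_sum x y u = case_sum x' y' u" if "u \<in> vars T S" for u
    using that assms(2,3) by (auto simp: ex_vars)
  moreover have "f \<subseteq> vars T S \<times> vars T S" using assms(1) unfolding K1_graph_def by blast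
  ultimately show ?thesis unfolding compatible_def by (intro ball_cong) auto
qed

type_synonym 'a labelled = "shape \<times> 'a list"

definition shape_of :: "'a labelled list \<Rightarrow> shape" where "shape_of \<Gamma> = concat (map fst \<Gamma>)"
definition labels_of :: "'a labelled list \<Rightarrow> 'a list" where "labels_of \<Gamma> = concat (map snd \<Gamma>)"
definition wf_context :: "'a labelled list \<Rightarrow> bool" where
  "wf_context \<Gamma> \<longleftrightarrow> (\<forall>(T, x)\<in>set \<Gamma>. length x = nv T)"

text \<open>Labels may occur any number of times here, so transitivity and the other rules need no linearity
condition.  A graph is determined by the labels only where each of them occurs exactly twice.\<close>

definition entails :: "'a labelled list \<Rightarrow> 'a labelled list \<Rightarrow> bool" where
  "entails \<Gamma> \<Delta> \<longleftrightarrow> wf_context \<Gamma> \<and> wf_context \<Delta> \<and>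
     (\<exists>f. allowable (shape_of \<Gamma>) (shape_of \<Delta>) f \<and>
          compatible f ((!) (labels_of \<Gamma>)) ((!) (labels_of \<Delta>)))"

definition atom :: "'a \<Rightarrow> 'a labelled" where "atom a = (\<one>\<^sub>s, [a])"
definition impl :: "'a labelled list \<Rightarrow> 'a labelled list \<Rightarrow> 'a labelled" where
  "impl \<Gamma> \<Delta> = (\<lblot>shape_of \<Gamma>, shape_of \<Delta>\<rblot>, labels_of \<Gamma> @ labels_of \<Delta>)"

lemma shape_of_simps [simp]:
  "shape_of [] = \<I>" "shape_of (A # \<Gamma>) = fst A \<otimes>\<^sub>s shape_of \<Gamma>"
  "shape_of (\<Gamma> @ \<Delta>) = shape_of \<Gamma> \<otimes>\<^sub>s shape_of \<Delta>"
  by (simp_all add: shape_of_def)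

lemma labels_of_simps [simp]:
  "labels_of [] = []" "labels_of (A # \<Gamma>) = snd A @ labels_of \<Gamma>"
  "labels_of (\<Gamma> @ \<Delta>) = labels_of \<Gamma> @ labels_of \<Delta>"
  by (simp_all add: labels_of_def)

lemma wf_context_simps [simp]:
  "wf_context []" "wf_context (A # \<Gamma>) \<longleftrightarrow> length (snd A) = nv (fst A) \<and> wf_context \<Gamma>"
  "wf_context (\<Gamma> @ \<Delta>) \<longleftrightarrow> wf_context \<Gamma> \<and> wf_context \<Delta>"
  by (auto simp: wf_context_def)

lemma length_labels_of: "wf_context \<Gamma> \<Longrightarrow> length (labels_of \<Gamma>) = nv (shape_of \<Gamma>)"
  by (induction \<Gamma>) (simp_all add: v_tensor v_unit)

lemma impl_simps [simp]:
  "fst (impl \<Gamma> \<Delta>) = \<lblot>shape_of \<Gamma>, shape_of \<Delta>\<rblot>" "snd (impl \<Gamma> \<Delta>) = labels_of \<Gamma> @ labels_of \<Delta>"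
  by (simp_all add: impl_def)

lemma atom_simps [simp]: "fst (atom a) = \<one>\<^sub>s" "snd (atom a) = [a]"
  by (simp_all add: atom_def)

lemma wf_impl: "wf_context \<Gamma> \<Longrightarrow> wf_context \<Delta> \<Longrightarrow> wf_context [impl \<Gamma> \<Delta>]"
  by (simp add: length_labels_of v_ihom)

lemma wf_atoms: "wf_context (map atom as)"
  by (auto simp: wf_context_def atom_def v_one)

lemma entails_refl: "wf_context \<Gamma> \<Longrightarrow> entails \<Gamma> \<Gamma>"
  unfolding entails_def using allowable_id by (fastforce simp: compatible_id)

lemma entails_trans:
  assumes "entails \<Gamma> \<Delta>" "entails \<Delta> \<Theta>"
  shows "entails \<Gamma> \<Theta>"
proof -
  from assms obtain f g where wf: "wf_context \<Gamma>" "wf_context \<Theta>"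
    and f: "allowable (shape_of \<Gamma>) (shape_of \<Delta>) f"
      "compatible f ((!) (labels_of \<Gamma>)) ((!) (labels_of \<Delta>))"
    and g: "allowable (shape_of \<Delta>) (shape_of \<Theta>) g"
      "compatible g ((!) (labels_of \<Delta>)) ((!) (labels_of \<Theta>))"
    unfolding entails_def by blast
  have "sym f" "sym g" using allowable_K1[OF f(1)] allowable_K1[OF g(1)] by (auto simp: K1_graph_def)
  then have "compatible (comp_graph g f) ((!) (labels_of \<Gamma>)) ((!) (labels_of \<Theta>))"
    using f(2) g(2) compatible_comp by blast
  then show ?thesis unfolding entails_def using wf allowable_comp[OF f(1) g(1)] by blast
qed

lemma entails_tensor:
  assumes "entails \<Gamma> \<Gamma>'" "entails \<Delta> \<Delta>'"
  shows "entails (\<Gamma> @ \<Delta>) (\<Gamma>' @ \<Delta>')"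
proof -
  from assms obtain f g where wf: "wf_context \<Gamma>" "wf_context \<Gamma>'" "wf_context \<Delta>" "wf_context \<Delta>'"
    and f: "allowable (shape_of \<Gamma>) (shape_of \<Gamma>') f"
      "compatible f ((!) (labels_of \<Gamma>)) ((!) (labels_of \<Gamma>'))"
    and g: "allowable (shape_of \<Delta>) (shape_of \<Delta>') g"
      "compatible g ((!) (labels_of \<Delta>)) ((!) (labels_of \<Delta>'))"
    unfolding entails_def by blast
  have "compatible f ((!) (labels_of (\<Gamma> @ \<Delta>))) ((!) (labels_of (\<Gamma>' @ \<Delta>')))"
    using f(2) by (subst compatible_cong[OF allowable_K1[OF f(1)]])
      (simp_all add: nth_append length_labels_of wf)
  moreover have "compatible g (\<lambda>i. labels_of (\<Gamma> @ \<Delta>) ! (nv (shape_of \<Gamma>) + i))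
      (\<lambda>j. labels_of (\<Gamma>' @ \<Delta>') ! (nv (shape_of \<Gamma>') + j))"
    using g(2) by (simp add: nth_append length_labels_of wf)
  ultimately show ?thesis
    unfolding entails_def using wf allowable_tensor[OF f(1) g(1)] by (auto simp: compatible_tensor)
qed

lemma entails_swap: "wf_context \<Gamma> \<Longrightarrow> wf_context \<Delta> \<Longrightarrow> entails (\<Gamma> @ \<Delta>) (\<Delta> @ \<Gamma>)"
  unfolding entails_def
  by (auto intro!: exI[of _ "c_graph (shape_of \<Gamma>) (shape_of \<Delta>)"] allowable_c
      simp: compatible_c nth_append length_labels_of)

lemma entails_eval: "wf_context \<Gamma> \<Longrightarrow> wf_context \<Delta> \<Longrightarrow> entails (impl \<Gamma> \<Delta> # \<Gamma>) \<Delta>"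
  unfolding entails_def using wf_impl[of \<Gamma> \<Delta>]
  by (auto intro!: exI[of _ "e_graph (shape_of \<Gamma>) (shape_of \<Delta>)"]
      allowable_e[of "shape_of \<Gamma>" "shape_of \<Delta>", simplified]
      simp: compatible_e nth_append length_labels_of)

lemma entails_curry:
  assumes "wf_context \<Gamma>" "wf_context \<Delta>" "entails (\<Gamma> @ \<Delta>) \<Theta>"
  shows "entails \<Gamma> [impl \<Delta> \<Theta>]"
proof (rule entails_trans)
  show "entails \<Gamma> [impl \<Delta> (\<Gamma> @ \<Delta>)]"
    unfolding entails_def using assms(1,2) wf_impl[of \<Delta> "\<Gamma> @ \<Delta>"]
    by (auto intro!: exI[of _ "d_graph (shape_of \<Gamma>) (shape_of \<Delta>)"] allowable_d
        simp: compatible_d nth_append length_labels_of)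
  from assms(3) obtain f where wf: "wf_context \<Theta>"
    and f: "allowable (shape_of (\<Gamma> @ \<Delta>)) (shape_of \<Theta>) f"
      "compatible f ((!) (labels_of (\<Gamma> @ \<Delta>))) ((!) (labels_of \<Theta>))"
    unfolding entails_def by blast
  let ?g = "hom_graph (shape_of \<Delta>) (shape_of \<Delta>) (id_graph (shape_of \<Delta>)) f"
  have "allowable (shape_of [impl \<Delta> (\<Gamma> @ \<Delta>)]) (shape_of [impl \<Delta> \<Theta>]) ?g"
    using allowable_hom[OF allowable_id f(1)] by simp
  moreover have "compatible ?g ((!) (labels_of [impl \<Delta> (\<Gamma> @ \<Delta>)])) ((!) (labels_of [impl \<Delta> \<Theta>]))"
    using f(2) length_labels_of[OF assms(2)]
    by (simp add: compatible_hom compatible_id nth_append_left flip: length_labels_of[OF assms(2)])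
  ultimately show "entails [impl \<Delta> (\<Gamma> @ \<Delta>)] [impl \<Delta> \<Theta>]"
    unfolding entails_def using assms(1,2) wf wf_impl[of \<Delta> "\<Gamma> @ \<Delta>"] wf_impl[of \<Delta> \<Theta>] by auto
qed

text \<open>A permutation is built from the symmetry \<open>c\<close> by moving the factors one at a time to their places.\<close>

lemma entails_perm: "mset \<Gamma> = mset \<Delta> \<Longrightarrow> wf_context \<Gamma> \<Longrightarrow> entails \<Gamma> \<Delta>"
proof (induction \<Gamma> arbitrary: \<Delta>)
  case Nil
  then show ?case by (simp add: entails_refl)
next
  case (Cons A \<Gamma>)
  then have "A \<in> set \<Delta>" by (metis list.set_intros(1) mset_eq_setD)
  then obtain \<Delta>1 \<Delta>2 where \<Delta>: "\<Delta> = \<Delta>1 @ A # \<Delta>2" by (meson split_list)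
  have wfA: "wf_context [A]" and "wf_context \<Gamma>" using Cons.prems by auto
  then have IH: "entails \<Gamma> (\<Delta>1 @ \<Delta>2)" using Cons.prems \<Delta> by (intro Cons.IH) auto
  then have wf: "wf_context \<Delta>1" "wf_context \<Delta>2" by (auto simp: entails_def)
  have "entails ([A] @ \<Gamma>) ([A] @ \<Delta>1 @ \<Delta>2)"
    by (rule entails_tensor[OF entails_refl[OF wfA] IH])
  moreover have "entails (([A] @ \<Delta>1) @ \<Delta>2) ((\<Delta>1 @ [A]) @ \<Delta>2)"
    by (rule entails_tensor[OF entails_swap[OF wfA wf(1)] entails_refl[OF wf(2)]])
  ultimately show ?case unfolding \<Delta> by (simp add: entails_trans)
qed

lemma entails_concat:
  "(\<And>i. i \<in> set is \<Longrightarrow> entails (\<Gamma> i) (\<Delta> i)) \<Longrightarrow> entails (concat (map \<Gamma> is)) (concat (map \<Delta> is))"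
  by (induction "is") (auto simp: entails_refl intro: entails_tensor)

section \<open>Planar trees as sets of addresses\<close>

lemma leaves_Node:
  "leaves (Node ts) = concat (map (\<lambda>j. map ((#) j) (leaves (ts ! j))) [0..<length ts])"
proof -
  have "map (\<lambda>(j, as). map ((#) j) as) (enumerate 0 (map leaves ts)) =
      map (\<lambda>j. map ((#) j) (leaves (ts ! j))) [0..<length ts]"
    by (rule nth_equalityI) (auto simp: nth_enumerate_eq)
  then show ?thesis by simp
qed

lemma nodes_Node: "nodes (Node ts) = insert [] (\<Union>j<length ts. (#) j ` nodes (ts ! j))"
  by simp

declare leaves.simps(2) [simp del] nodes.simps(2) [simp del]
declare leaves_Node [simp] nodes_Node [simp]

lemma Nil_in_nodes [simp]: "[] \<in> nodes T \<longleftrightarrow> T \<noteq> Null"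
  by (cases T) auto

lemma Cons_in_nodes [simp]: "j # a \<in> nodes (Node ts) \<longleftrightarrow> j < length ts \<and> a \<in> nodes (ts ! j)"
  by auto

lemma Nil_in_leaves [simp]: "[] \<in> set (leaves T) \<longleftrightarrow> T = Null"
  by (cases T) auto

lemma Cons_in_leaves [simp]:
  "j # a \<in> set (leaves (Node ts)) \<longleftrightarrow> j < length ts \<and> a \<in> set (leaves (ts ! j))"
  by auto

declare nodes_Node [simp del]

text \<open>The edges correspond to the mated pairs of the morphism of a tree, and their two descriptions,
  by the node or leaf at the start and by the input or root at the end (\<open>snoc_in_edges\<close>), to the
  negative and the positive member of a pair.\<close>

definition edges :: "ptree \<Rightarrow> address set" where "edges T = nodes T \<union> set (leaves T)"

lemma edges_simps [simp]:
  "[] \<in> edges T" "edges Null = {[]}"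
  "j # a \<in> edges (Node ts) \<longleftrightarrow> j < length ts \<and> a \<in> edges (ts ! j)"
  by (auto simp: edges_def)

lemma nodes_leaves_disjoint: "a \<in> nodes T \<Longrightarrow> a \<notin> set (leaves T)"
proof (induction a arbitrary: T)
  case (Cons j a)
  then show ?case by (cases T) (auto simp del: leaves_Node)
qed simp

lemma snoc_in_edges: "a @ [j] \<in> edges T \<longleftrightarrow> a \<in> nodes T \<and> j < inputs T a"
proof (induction a arbitrary: T)
  case Nil
  then show ?case by (cases T) auto
next
  case (Cons i a)
  then show ?case by (cases T) auto
qed

lemma finite_nodes [simp]: "finite (nodes T)"
proof (induction T)
  case (Node ts)
  then show ?case by (simp add: nodes_Node)
qed simp

lemma distinct_concat_Cons:
  "distinct is \<Longrightarrow> (\<And>j. j \<in> set is \<Longrightarrow> distinct (F j)) \<Longrightarrow>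
    distinct (concat (map (\<lambda>j. map ((#) j) (F j)) is))"
  by (induction "is") (auto simp: distinct_map)

lemma distinct_leaves: "distinct (leaves T)"
  by (induction T) (auto intro!: distinct_concat_Cons simp: nth_mem)

text \<open>Derivations are about lists of factors; the order in which the nodes are listed is immaterial, and
this one follows the recursion of the tree.\<close>

primrec node_list :: "ptree \<Rightarrow> address list" where
  "node_list Null = []"
| "node_list (Node ts) =
     [] # concat (map (\<lambda>(j, as). map ((#) j) as) (enumerate 0 (map node_list ts)))"

lemma node_list_Node:
  "node_list (Node ts) = [] # concat (map (\<lambda>j. map ((#) j) (node_list (ts ! j))) [0..<length ts])"
proof -
  have "map (\<lambda>(j, as). map ((#) j) as) (enumerate 0 (map node_list ts)) =
      map (\<lambda>j. map ((#) j) (node_list (ts ! j))) [0..<length ts]"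
    by (rule nth_equalityI) (auto simp: nth_enumerate_eq)
  then show ?thesis by simp
qed

lemma distinct_node_list: "distinct (node_list T)"
  by (induction T)
    (auto simp: node_list_Node nth_mem simp del: node_list.simps(2) intro!: distinct_concat_Cons)

lemma set_node_list: "set (node_list T) = nodes T"
  by (induction T)
    (auto simp: node_list_Node nodes_Node nth_mem simp del: node_list.simps(2))

lemma nodes_inputs_inject:
  "nodes T = nodes T' \<Longrightarrow> (\<And>a. a \<in> nodes T \<Longrightarrow> inputs T a = inputs T' a) \<Longrightarrow> T = T'"
proof (induction T arbitrary: T')
  case Null
  then show ?case using Nil_in_nodes[of T'] by auto
next
  case (Node ts)
  then have "T' \<noteq> Null" using Nil_in_nodes[of T'] Nil_in_nodes[of "Node ts"] by blast
  then obtain ts' where T': "T' = Node ts'" by (cases T') auto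
  have len: "length ts = length ts'" using Node.prems(2)[of "[]"] T' by simp
  have "ts ! j = ts' ! j" if "j < length ts" for j
  proof (rule Node.IH)
    show "ts ! j \<in> set ts" using that by simp
    have "j # a \<in> nodes (Node ts) \<longleftrightarrow> j # a \<in> nodes (Node ts')" for a
      using Node.prems(1) T' by simp
    then show "nodes (ts ! j) = nodes (ts' ! j)" using that len by auto
    show "inputs (ts ! j) a = inputs (ts' ! j) a" if "a \<in> nodes (ts ! j)" for a
      using Node.prems(2)[of "j # a"] that \<open>j < length ts\<close> T' by simp
  qed
  then show ?case using len T' by (simp add: list_eq_iff_nth_eq)
qed

text \<open>If \<open>N\<close> is not empty it contains the root, and the subtree on input \<open>j\<close> of the root comes from the
smaller set of the addresses in \<open>N\<close> that start with \<open>j\<close>.\<close>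

lemma ptree_of_addresses:
  assumes "finite N" "\<And>a j. a @ [j] \<in> N \<Longrightarrow> a \<in> N \<and> j < n a"
  shows "\<exists>T. nodes T = N \<and> (\<forall>a\<in>N. inputs T a = n a)"
  using assms
proof (induction "card N" arbitrary: N n rule: less_induct)
  case less
  have prefix: "a \<in> N" if "a @ b \<in> N" for a b
    using that by (induction b rule: rev_induct) (auto simp flip: append_assoc dest: less.prems(2))
  show ?case
  proof (cases "N = {}")
    case True
    then show ?thesis by (intro exI[of _ Null]) simp
  next
    case False
    then have root: "[] \<in> N" using prefix[of "[]"] by auto
    define M where "M j = {a. j # a \<in> N}" for j
    have "\<exists>T. nodes T = M j \<and> (\<forall>a\<in>M j. inputs T a = n (j # a))" for j
    proof (rule less.hyps)
      have sub: "(#) j ` M j \<subseteq> N - {[]}" unfolding M_def by auto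
      then have fin: "finite ((#) j ` M j)" using less.prems(1) finite_subset by blast
      then show "finite (M j)" by (rule finite_imageD) simp
      have "card (M j) = card ((#) j ` M j)" by (simp add: card_image)
      also have "\<dots> \<le> card (N - {[]})" using sub less.prems(1) by (simp add: card_mono)
      also have "\<dots> < card N" using root less.prems(1) by (meson card_Diff1_less)
      finally show "card (M j) < card N" .
      show "a \<in> M j \<and> i < n (j # a)" if "a @ [i] \<in> M j" for a i
        using that less.prems(2)[of "j # a" i] unfolding M_def by simp
    qed
    then obtain t where t: "nodes (t j) = M j" "\<And>a. a \<in> M j \<Longrightarrow> inputs (t j) a = n (j # a)" for j
      by metis
    have bound: "j < n []" if "j # a \<in> N" for j a
      using prefix[of "[j]" a] that less.prems(2)[of "[]" j] by simp
    let ?T = "Node (map t [0..<n []])"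
    have "a \<in> nodes ?T \<longleftrightarrow> a \<in> N" for a
      using root bound t(1) by (cases a) (auto simp: M_def)
    moreover have "inputs ?T a = n a" if "a \<in> N" for a
      using that bound t(2) by (cases a) (auto simp: M_def)
    ultimately show ?thesis by blast
  qed
qed

text \<open>Both sides count the edges, by their starts and by their ends.\<close>

lemma card_edges: "length (leaves T) + card (nodes T) = (\<Sum>a\<in>nodes T. inputs T a) + 1"
proof -
  have "edges T = insert [] ((\<lambda>(a, j). a @ [j]) ` (SIGMA a:nodes T. {..<inputs T a}))"
    (is "_ = insert [] (?snoc ` ?S)")
  proof (rule set_eqI)
    fix e show "e \<in> edges T \<longleftrightarrow> e \<in> insert [] (?snoc ` ?S)"
      by (cases e rule: rev_cases) (auto simp: snoc_in_edges image_iff)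
  qed
  moreover have "card (insert [] (?snoc ` ?S)) = 1 + card ?S"
    by (subst card_insert_disjoint) (auto simp: card_image inj_on_def)
  moreover have "card (edges T) = card (nodes T) + card (set (leaves T))"
    unfolding edges_def by (intro card_Un_disjoint) (auto dest: nodes_leaves_disjoint)
  ultimately show ?thesis
    by (simp add: distinct_card distinct_leaves)
qed

section \<open>A tree is a derivation\<close>

text \<open>The factor \<open>X\<close> of a node, each variable labelled by its edge.  Addresses are prefixed by \<open>p\<close>, so
that the formulas of a subtree are literally those of the tree that contains it.\<close>

definition node_formula :: "address \<Rightarrow> ptree \<Rightarrow> address \<Rightarrow> address labelled" where
  "node_formula p T a = impl (map (\<lambda>j. atom (p @ a @ [j])) [0..<inputs T a]) [atom (p @ a)]"

lemma wf_node_formula: "wf_context [node_formula p T a]"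
  using wf_impl[of "map atom (map (\<lambda>j. p @ a @ [j]) [0..<inputs T a])" "map atom [p @ a]"]
    wf_atoms[of "map (\<lambda>j. p @ a @ [j]) [0..<inputs T a]"] wf_atoms[of "[p @ a]"]
  by (simp add: node_formula_def o_def del: wf_context_simps)

lemma wf_node_formulas: "wf_context (map (node_formula p T) as)"
  using wf_node_formula by (induction as) auto

lemma node_formula_Cons:
  "node_formula p (Node ts) (j # a) = node_formula (p @ [j]) (ts ! j) a"
  by (simp add: node_formula_def)

lemma mset_concat_append:
  "mset (concat (map (\<lambda>i. F i @ G i) is)) = mset (concat (map F is)) + mset (concat (map G is))"
  by (induction "is") auto

text \<open>The subtrees on the inputs of the root node entail the labels of these inputs, and evaluation at the
formula of the root node turns the latter into the label of the root.\<close>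

lemma tree_entails_root:
  "entails (map (node_formula p T) (node_list T) @ map (\<lambda>a. atom (p @ a)) (leaves T)) [atom p]"
proof (induction T arbitrary: p)
  case Null
  then show ?case using entails_refl[of "[atom p]"] wf_atoms[of "[p]"] by simp
next
  case (Node ts)
  let ?n = "length ts"
  let ?N = "\<lambda>j. map (node_formula (p @ [j]) (ts ! j)) (node_list (ts ! j))"
  let ?L = "\<lambda>j. map (\<lambda>a. atom (p @ [j] @ a)) (leaves (ts ! j))"
  let ?root = "node_formula p (Node ts) []"
  let ?ins = "map (\<lambda>j. atom (p @ [j])) [0..<?n]"
  have nodes: "map (node_formula p (Node ts)) (node_list (Node ts)) = ?root # concat (map ?N [0..<?n])"
    by (simp add: node_list_Node map_concat o_def node_formula_Cons del: node_list.simps(2))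
  have leaves: "map (\<lambda>a. atom (p @ a)) (leaves (Node ts)) = concat (map ?L [0..<?n])"
    by (simp add: map_concat o_def)
  have "entails (?N j @ ?L j) [atom (p @ [j])]" if "j \<in> set [0..<?n]" for j
    using Node.IH[of "ts ! j" "p @ [j]"] that by simp
  then have "entails (concat (map (\<lambda>j. ?N j @ ?L j) [0..<?n])) (concat (map (\<lambda>j. [atom (p @ [j])]) [0..<?n]))"
    by (rule entails_concat)
  moreover have "concat (map (\<lambda>j. [atom (p @ [j])]) [0..<?n]) = ?ins" by (simp add: concat_map_singleton)
  ultimately have "entails (concat (map (\<lambda>j. ?N j @ ?L j) [0..<?n])) ?ins" by simp
  then have sub: "entails ([?root] @ concat (map (\<lambda>j. ?N j @ ?L j) [0..<?n])) ([?root] @ ?ins)"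
    by (intro entails_tensor entails_refl wf_node_formula)
  have "entails (map (node_formula p (Node ts)) (node_list (Node ts)) @ map (\<lambda>a. atom (p @ a)) (leaves (Node ts)))
      ([?root] @ concat (map (\<lambda>j. ?N j @ ?L j) [0..<?n]))"
  proof (rule entails_perm)
    show "wf_context (map (node_formula p (Node ts)) (node_list (Node ts)) @ map (\<lambda>a. atom (p @ a)) (leaves (Node ts)))"
      using wf_atoms[of "map ((@) p) (leaves (Node ts))"] wf_node_formulas
      by (simp only: wf_context_simps map_map o_def)
    show "mset (map (node_formula p (Node ts)) (node_list (Node ts)) @ map (\<lambda>a. atom (p @ a)) (leaves (Node ts))) =
        mset ([?root] @ concat (map (\<lambda>j. ?N j @ ?L j) [0..<?n]))"
      unfolding nodes leaves mset_append mset_concat_append by simp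
  qed
  moreover have "entails ([?root] @ ?ins) [atom p]"
    using entails_eval[of ?ins "[atom p]"] wf_atoms[of "map (\<lambda>j. p @ [j]) [0..<?n]"] wf_atoms[of "[p]"]
    by (simp add: node_formula_def o_def)
  ultimately show ?case using sub entails_trans by blast
qed

lemma tree_derivation:
  assumes "mset ns = mset (node_list T)" "mset ls = mset (leaves T)"
  shows "entails (map (node_formula [] T) ns) [impl (map atom ls) [atom []]]"
proof (rule entails_curry)
  show wf: "wf_context (map (node_formula [] T) ns)" "wf_context (map atom ls)"
    by (rule wf_node_formulas, rule wf_atoms)
  have "entails (map (node_formula [] T) ns @ map atom ls)
      (map (node_formula [] T) (node_list T) @ map atom (leaves T))"
    by (rule entails_perm) (use wf assms in \<open>auto\<close>)
  then show "entails (map (node_formula [] T) ns @ map atom ls) [atom []]"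
    using tree_entails_root[of "[]" T] entails_trans by simp blast
qed

section \<open>The variables of a graph between tensors of \<open>X\<close>\<close>

text \<open>The factors of a tensor product occupy consecutive blocks of variables.  The lemmas on blocks say
that a variable is determined by its block and its position in the block, and conversely.\<close>

lemma nth_concat_upt:
  assumes "i < k" "j < length (F i)"
  shows "concat (map F [0..<k]) ! ((\<Sum>r<i. length (F r)) + j) = F i ! j"
  using assms
proof (induction k)
  case (Suc k)
  have len: "length (concat (map F [0..<k])) = (\<Sum>r<k. length (F r))" for k
    by (induction k) simp_all
  show ?case
  proof (cases "i < k")
    case True
    have "(\<Sum>r<i. length (F r)) + j < (\<Sum>r<Suc i. length (F r))" using Suc.prems by simp
    also have "\<dots> \<le> (\<Sum>r<k. length (F r))" using True by (intro sum_mono2) auto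
    finally show ?thesis using Suc True by (simp add: nth_append len)
  next
    case False
    then have "i = k" using Suc.prems by simp
    then show ?thesis using Suc.prems by (simp add: nth_append len)
  qed
qed simp

lemma index_block_ex:
  fixes h :: "nat \<Rightarrow> nat"
  shows "n < (\<Sum>r<k. h r) \<Longrightarrow> \<exists>i<k. \<exists>j<h i. n = (\<Sum>r<i. h r) + j"
proof (induction k)
  case (Suc k)
  show ?case
  proof (cases "n < (\<Sum>r<k. h r)")
    case True
    then show ?thesis using Suc.IH less_SucI by metis
  next
    case False
    then show ?thesis
      using Suc.prems by (intro exI[of _ k] conjI exI[of _ "n - (\<Sum>r<k. h r)"]) auto
  qed
qed simp

lemma index_block_mono:
  fixes h :: "nat \<Rightarrow> nat"
  assumes "i < i'" "j < h i"
  shows "(\<Sum>r<i. h r) + j < (\<Sum>r<i'. h r :: nat)"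
proof -
  have "(\<Sum>r<i. h r) + j < (\<Sum>r<Suc i. h r)" using assms by simp
  also have "\<dots> \<le> (\<Sum>r<i'. h r)" using assms by (intro sum_mono2) auto
  finally show ?thesis .
qed

lemma index_block_inject:
  fixes h :: "nat \<Rightarrow> nat"
  assumes "j < h i" "j' < h i'" "(\<Sum>r<i. h r) + j = (\<Sum>r<i'. h r) + (j' :: nat)"
  shows "i = i' \<and> j = j'"
proof -
  have "\<not> i < i'" "\<not> i' < i"
    using index_block_mono[of i i' j h] index_block_mono[of i' i j' h] assms by auto
  then show ?thesis using assms(3) by auto
qed

lemma v_X: "v (X n) = replicate n False @ [True]"
proof -
  have "v (tensor_list (replicate n \<one>\<^sub>s)) = replicate n True"
    by (induction n) (simp_all add: v_def)
  then show ?thesis by (simp add: X_def v_ihom v_one)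
qed

lemma X_tensor_upt: "X_tensor m = concat (map (\<lambda>i. X (m ! i)) [0..<length m])"
proof -
  have "map X m = map (\<lambda>i. X (m ! i)) [0..<length m]" by (rule nth_equalityI) simp_all
  then show ?thesis by (simp only: X_tensor_def)
qed

lemma v_concat: "v (concat Ts) = concat (map v Ts)"
  by (induction Ts) (simp_all add: v_unit v_tensor)

lemma v_X_tensor:
  "v (X_tensor m) = concat (map (\<lambda>i. replicate (m ! i) False @ [True]) [0..<length m])"
  by (simp add: X_tensor_upt v_concat o_def v_X)

lemma nv_X [simp]: "nv (X n) = n + 1" by (simp add: v_X)

lemma nv_X_tensor: "nv (X_tensor m) = (\<Sum>r<length m. m ! r + 1)"
proof -
  have "length (concat (map (\<lambda>i. replicate (m ! i) False @ [True]) [0..<k])) = (\<Sum>r<k. m ! r + 1)" for k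
    by (induction k) simp_all
  then show ?thesis by (simp add: v_X_tensor)
qed

lemma nth_X_tensor:
  assumes "i < length m" "j < m ! i + 1" "\<And>r. length (F r) = m ! r + 1"
  shows "concat (map F [0..<length m]) ! ((\<Sum>r<i. m ! r + 1) + j) = F i ! j"
  using nth_concat_upt[of i "length m" j F] assms by simp

lemma variance_A_in: "i < length m \<Longrightarrow> j < m ! i \<Longrightarrow> variance (X_tensor m) S (A_in m i j)"
  using nth_X_tensor[of i m j "\<lambda>i. replicate (m ! i) False @ [True]"]
  by (simp add: variance_def A_in_def v_X_tensor nth_append)

lemma variance_A_out: "i < length m \<Longrightarrow> \<not> variance (X_tensor m) S (A_out m i)"
  using nth_X_tensor[of i m "m ! i" "\<lambda>i. replicate (m ! i) False @ [True]"]
  by (simp add: variance_def A_out_def v_X_tensor nth_append)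

lemma variance_B_in: "p < l \<Longrightarrow> \<not> variance S (X l) (B_in p)"
  by (simp add: variance_def B_in_def v_X nth_append)

lemma variance_B_out: "variance S (X l) (B_out l)"
  by (simp add: variance_def B_out_def v_X nth_append)

lemma A_in_inject:
  "j < m ! i \<Longrightarrow> j' < m ! i' \<Longrightarrow> A_in m i j = A_in m i' j' \<longleftrightarrow> i = i' \<and> j = j'"
  using index_block_inject[of j "\<lambda>r. m ! r + 1" i j' i'] by (auto simp: A_in_def)

lemma A_out_inject: "A_out m i = A_out m i' \<longleftrightarrow> i = i'"
  using index_block_inject[of "m ! i" "\<lambda>r. m ! r + 1" i "m ! i'" i'] by (auto simp: A_out_def)

lemma B_in_inject: "B_in p = B_in p' \<longleftrightarrow> p = p'"
  by (simp add: B_in_def)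

lemma A_B_distinct [simp]:
  "A_in m i j \<noteq> B_in p" "A_in m i j \<noteq> B_out l" "A_out m i \<noteq> B_in p" "A_out m i \<noteq> B_out l"
  "B_in p \<noteq> A_in m i j" "B_out l \<noteq> A_in m i j" "B_in p \<noteq> A_out m i" "B_out l \<noteq> A_out m i"
  by (simp_all add: A_in_def A_out_def B_in_def B_out_def)

lemma vars_X:
  "u \<in> vars (X_tensor m) (X l) \<longleftrightarrow>
     (\<exists>i<length m. \<exists>j<m ! i. u = A_in m i j) \<or> (\<exists>i<length m. u = A_out m i) \<or>
     (\<exists>p<l. u = B_in p) \<or> u = B_out l" (is "_ \<longleftrightarrow> ?R")
proof
  assume "u \<in> vars (X_tensor m) (X l)"
  then consider (dom) n where "u = Inl n" "n < (\<Sum>r<length m. m ! r + 1)" | (cod) n where "u = Inr n" "n < l + 1"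
    by (auto simp: ex_vars nv_X_tensor)
  then show ?R
  proof cases
    case dom
    then obtain i j where "i < length m" "j < m ! i + 1" "n = (\<Sum>r<i. m ! r + 1) + j"
      using index_block_ex[of n "\<lambda>r. m ! r + 1" "length m"] by blast
    then show ?thesis using dom(1) by (cases "j = m ! i") (auto simp: A_in_def A_out_def)
  next
    case cod
    then show ?thesis by (cases "n = l") (auto simp: B_in_def B_out_def)
  qed
next
  assume ?R
  moreover have "(\<Sum>r<i. m ! r + 1) + j < nv (X_tensor m)" if "i < length m" "j < m ! i + 1" for i j
    unfolding nv_X_tensor using index_block_mono[of i "length m" j "\<lambda>r. m ! r + 1"] that by simp
  ultimately show "u \<in> vars (X_tensor m) (X l)"
    by (auto simp: ex_vars A_in_def A_out_def B_in_def B_out_def)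
qed

lemma in_vars_X:
  "i < length m \<Longrightarrow> j < m ! i \<Longrightarrow> A_in m i j \<in> vars (X_tensor m) (X l)"
  "i < length m \<Longrightarrow> A_out m i \<in> vars (X_tensor m) (X l)"
  "p < l \<Longrightarrow> B_in p \<in> vars (X_tensor m) (X l)"
  "B_out l \<in> vars (X_tensor m) (X l)"
  unfolding vars_X by blast+

lemmas variance_simps = variance_A_in variance_A_out variance_B_in variance_B_out

lemma positive_cases:
  assumes "u \<in> vars (X_tensor m) (X l)" "variance (X_tensor m) (X l) u"
  obtains i j where "i < length m" "j < m ! i" "u = A_in m i j" | "u = B_out l"
  using assms variance_A_out variance_B_in unfolding vars_X by metis

lemma negative_cases:
  assumes "u \<in> vars (X_tensor m) (X l)" "\<not> variance (X_tensor m) (X l) u"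
  obtains i where "i < length m" "u = A_out m i" | p where "p < l" "u = B_in p"
  using assms variance_A_in variance_B_out unfolding vars_X by metis

section \<open>The morphism of a tree\<close>

lemma matching_labelling:
  assumes inj: "\<And>u w. u \<in> V \<Longrightarrow> w \<in> V \<Longrightarrow> L u = L w \<Longrightarrow> s u = s w \<Longrightarrow> u = w"
    and ex: "\<And>u. u \<in> V \<Longrightarrow> \<exists>w\<in>V. L u = L w \<and> s u \<noteq> s w"
  shows "matching V s {(u, w). u \<in> V \<and> w \<in> V \<and> u \<noteq> w \<and> L u = L w}"
proof (rule matchingI)
  fix x y z
  assume "(x, y) \<in> {(u, w). u \<in> V \<and> w \<in> V \<and> u \<noteq> w \<and> L u = L w}"
    "(x, z) \<in> {(u, w). u \<in> V \<and> w \<in> V \<and> u \<noteq> w \<and> L u = L w}"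
  then have "x \<in> V" "y \<in> V" "z \<in> V" "x \<noteq> y" "x \<noteq> z" "L x = L y" "L x = L z" by auto
  then show "y = z" using inj[of x y] inj[of x z] inj[of y z] by auto
next
  fix x assume "x \<in> V"
  then obtain w where "w \<in> V" "L x = L w" "s x \<noteq> s w" using ex by blast
  then show "\<exists>y. (x, y) \<in> {(u, w). u \<in> V \<and> w \<in> V \<and> u \<noteq> w \<and> L u = L w}"
    using \<open>x \<in> V\<close> by (intro exI[of _ w]) auto
next
  fix x y assume "(x, y) \<in> {(u, w). u \<in> V \<and> w \<in> V \<and> u \<noteq> w \<and> L u = L w}"
  then show "x \<in> V \<and> (y, x) \<in> {(u, w). u \<in> V \<and> w \<in> V \<and> u \<noteq> w \<and> L u = L w} \<and> (s x \<longleftrightarrow> \<not> s y)"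
    using inj[of x y] by auto
qed

lemma representsD:
  assumes "represents m l f (T, \<rho>, \<tau>)"
  shows "K1_graph (X_tensor m) (X l) f"
    and "\<And>a j. a \<in> nodes T \<Longrightarrow> j < inputs T a \<Longrightarrow> a @ [j] \<in> nodes T \<Longrightarrow>
      (A_in m (\<tau> a) j, A_out m (\<tau> (a @ [j]))) \<in> f"
    and "\<And>a j q. a \<in> nodes T \<Longrightarrow> j < inputs T a \<Longrightarrow> q < length (leaves T) \<Longrightarrow>
      leaves T ! q = a @ [j] \<Longrightarrow> (A_in m (\<tau> a) j, B_in (\<rho> q)) \<in> f"
    and "[] \<in> nodes T \<Longrightarrow> (A_out m (\<tau> []), B_out l) \<in> f"
    and "T = Null \<Longrightarrow> (B_in 0, B_out l) \<in> f"
  using assms unfolding represents.simps by blast+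

locale numbered_tree =
  fixes m :: "nat list" and l :: nat and T :: ptree and \<rho> :: "nat \<Rightarrow> nat" and \<tau> :: "address \<Rightarrow> nat"
  assumes combed: "combed_tree (T, \<rho>, \<tau>)"
    and inputs: "tree_inputs m (T, \<rho>, \<tau>)"
    and arity: "int l = (\<Sum>i<length m. int (m ! i)) - int (length m) + 1"
begin

abbreviation V :: "variable set" where "V \<equiv> vars (X_tensor m) (X l)"
abbreviation sgn :: "variable \<Rightarrow> bool" where "sgn \<equiv> variance (X_tensor m) (X l)"

lemma bij_\<tau>: "bij_betw \<tau> (nodes T) {..<length m}"
  using combed inputs by simp

lemma inputs_\<tau>: "a \<in> nodes T \<Longrightarrow> inputs T a = m ! \<tau> a"
  using inputs by simp

lemma length_leaves: "length (leaves T) = l"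
proof -
  have "(\<Sum>a\<in>nodes T. inputs T a) = (\<Sum>a\<in>nodes T. m ! \<tau> a)" by (simp add: inputs_\<tau>)
  also have "\<dots> = (\<Sum>i<length m. m ! i)" by (rule sum.reindex_bij_betw[OF bij_\<tau>])
  finally have "length (leaves T) + length m = (\<Sum>i<length m. m ! i) + 1"
    using card_edges[of T] inputs by simp
  moreover have "(\<Sum>i<length m. int (m ! i)) = int (\<Sum>i<length m. m ! i)" by simp
  ultimately show ?thesis using arity by linarith
qed

lemma perm_\<rho>: "\<rho> permutes {..<l}"
  using combed length_leaves by simp

definition node_at :: "nat \<Rightarrow> address" where "node_at = inv_into (nodes T) \<tau>"
definition leaf_at :: "nat \<Rightarrow> address" where "leaf_at p = leaves T ! inv \<rho> p"

lemma node_at_in: "i < length m \<Longrightarrow> node_at i \<in> nodes T"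
  unfolding node_at_def using bij_betw_apply[OF bij_betw_inv_into[OF bij_\<tau>]] by auto

lemma \<tau>_node_at: "i < length m \<Longrightarrow> \<tau> (node_at i) = i"
  unfolding node_at_def using bij_betw_inv_into_right[OF bij_\<tau>] by auto

lemma node_at_\<tau>: "a \<in> nodes T \<Longrightarrow> node_at (\<tau> a) = a"
  unfolding node_at_def using bij_betw_inv_into_left[OF bij_\<tau>] by auto

lemma \<tau>_less: "a \<in> nodes T \<Longrightarrow> \<tau> a < length m"
  using bij_betw_apply[OF bij_\<tau>] by auto

lemma inputs_node_at: "i < length m \<Longrightarrow> inputs T (node_at i) = m ! i"
  by (simp add: inputs_\<tau> node_at_in \<tau>_node_at)

lemma inv_\<rho>_less: "p < l \<Longrightarrow> inv \<rho> p < l"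
  using permutes_in_image[OF permutes_inv[OF perm_\<rho>]] by simp

lemma \<rho>_less: "q < l \<Longrightarrow> \<rho> q < l"
  using permutes_in_image[OF perm_\<rho>] by simp

lemma leaf_at_in: "p < l \<Longrightarrow> leaf_at p \<in> set (leaves T)"
  unfolding leaf_at_def using inv_\<rho>_less length_leaves by simp

lemma leaf_at_\<rho>: "leaf_at (\<rho> q) = leaves T ! q"
  unfolding leaf_at_def by (simp add: permutes_inverses(2)[OF perm_\<rho>])

lemma leaf_at_inject: "p < l \<Longrightarrow> p' < l \<Longrightarrow> leaf_at p = leaf_at p' \<Longrightarrow> p = p'"
  unfolding leaf_at_def
  using nth_eq_iff_index_eq[OF distinct_leaves, of "inv \<rho> p" T "inv \<rho> p'"] inv_\<rho>_less length_leaves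
    permutes_inverses(1)[OF perm_\<rho>] by metis

lemma ex_leaf_at: "e \<in> set (leaves T) \<Longrightarrow> \<exists>p<l. e = leaf_at p"
  using length_leaves leaf_at_\<rho> \<rho>_less by (metis in_set_conv_nth)

text \<open>Each variable is labelled by its edge.  The labels are listed in the order of the variables, as
labelled contexts require.\<close>

definition dom_labels :: "address list" where
  "dom_labels = concat (map (\<lambda>i. map (\<lambda>j. node_at i @ [j]) [0..<m ! i] @ [node_at i]) [0..<length m])"
definition cod_labels :: "address list" where
  "cod_labels = map leaf_at [0..<l] @ [[]]"
definition label :: "variable \<Rightarrow> address" where
  "label = case_sum ((!) dom_labels) ((!) cod_labels)"

lemma label_A_in: "i < length m \<Longrightarrow> j < m ! i \<Longrightarrow> label (A_in m i j) = node_at i @ [j]"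
  using nth_X_tensor[of i m j "\<lambda>i. map (\<lambda>j. node_at i @ [j]) [0..<m ! i] @ [node_at i]"]
  by (simp add: label_def A_in_def dom_labels_def nth_append)

lemma label_A_out: "i < length m \<Longrightarrow> label (A_out m i) = node_at i"
  using nth_X_tensor[of i m "m ! i" "\<lambda>i. map (\<lambda>j. node_at i @ [j]) [0..<m ! i] @ [node_at i]"]
  by (simp add: label_def A_out_def dom_labels_def nth_append)

lemma label_B_in: "p < l \<Longrightarrow> label (B_in p) = leaf_at p"
  by (simp add: label_def B_in_def cod_labels_def nth_append)

lemma label_B_out: "label (B_out l) = []"
  by (simp add: label_def B_out_def cod_labels_def nth_append)

lemmas label_simps = label_A_in label_A_out label_B_in label_B_out

lemma node_at_inject:
  "i < length m \<Longrightarrow> i' < length m \<Longrightarrow> node_at i = node_at i' \<longleftrightarrow> i = i'"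
  using \<tau>_node_at by metis

lemma label_inject:
  assumes "u \<in> V" "w \<in> V" "label u = label w" "sgn u = sgn w"
  shows "u = w"
proof (cases "sgn u")
  case True
  then have "sgn w" using assms(4) by simp
  from assms(1) True show ?thesis
  proof (cases rule: positive_cases)
    case u: (1 i j)
    from assms(2) \<open>sgn w\<close> show ?thesis
      by (cases rule: positive_cases) (use u assms(3) in \<open>auto simp: label_simps node_at_inject\<close>)
  next
    case u: 2
    from assms(2) \<open>sgn w\<close> show ?thesis
      by (cases rule: positive_cases) (use u assms(3) in \<open>auto simp: label_simps\<close>)
  qed
next
  case False
  then have "\<not> sgn w" using assms(4) by simp
  have no: "node_at i \<noteq> leaf_at p" if "i < length m" "p < l" for i p
    using node_at_in[OF that(1)] leaf_at_in[OF that(2)] nodes_leaves_disjoint by metis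
  from assms(1) False show ?thesis
  proof (cases rule: negative_cases)
    case u: (1 i)
    from assms(2) \<open>\<not> sgn w\<close> show ?thesis
      by (cases rule: negative_cases)
        (use u assms(3) no in \<open>auto simp: label_simps node_at_inject\<close>)
  next
    case u: (2 p)
    from assms(2) \<open>\<not> sgn w\<close> show ?thesis
    proof (cases rule: negative_cases)
      case w: (1 i)
      then show ?thesis using u assms(3) no[of i p] by (simp add: label_simps)
    next
      case w: (2 p')
      then show ?thesis using u assms(3) leaf_at_inject[of p p'] by (simp add: label_simps)
    qed
  qed
qed

lemma ex_positive: "e \<in> edges T \<Longrightarrow> \<exists>u\<in>V. sgn u \<and> label u = e"
proof (cases e rule: rev_cases)
  case Nil
  then show ?thesis using variance_B_out label_B_out by (intro bexI[of _ "B_out l"]) (auto simp: vars_X)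
next
  case (snoc a j)
  assume "e \<in> edges T"
  then have a: "a \<in> nodes T" "j < m ! \<tau> a" using snoc snoc_in_edges inputs_\<tau> by auto
  then show ?thesis
    using snoc \<tau>_less[of a] variance_A_in[of "\<tau> a" m j] label_A_in[of "\<tau> a" j] node_at_\<tau>
    by (intro bexI[of _ "A_in m (\<tau> a) j"]) (auto simp: vars_X)
qed

lemma ex_negative: "e \<in> edges T \<Longrightarrow> \<exists>u\<in>V. \<not> sgn u \<and> label u = e"
proof -
  assume "e \<in> edges T"
  then consider "e \<in> nodes T" | "e \<in> set (leaves T)" by (auto simp: edges_def)
  then show ?thesis
  proof cases
    case 1
    then show ?thesis using \<tau>_less[of e] variance_A_out[of "\<tau> e" m] label_A_out[of "\<tau> e"] node_at_\<tau>
      by (intro bexI[of _ "A_out m (\<tau> e)"]) (auto simp: vars_X)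
  next
    case 2
    then obtain p where "p < l" "e = leaf_at p" using ex_leaf_at by blast
    then show ?thesis using variance_B_in[of p l] label_B_in[of p]
      by (intro bexI[of _ "B_in p"]) (auto simp: vars_X)
  qed
qed

lemma label_in_edges: "u \<in> V \<Longrightarrow> label u \<in> edges T"
  unfolding vars_X
  by (auto simp: label_simps snoc_in_edges node_at_in inputs_node_at leaf_at_in)
    (auto simp: edges_def node_at_in leaf_at_in)

text \<open>This is \<open>\<xi>\<^sub>T\<close>, since mates are the two ends of an edge (\<open>represents_iff\<close>).\<close>

definition tree_graph :: graph where
  "tree_graph = {(u, w). u \<in> V \<and> w \<in> V \<and> u \<noteq> w \<and> label u = label w}"

lemma tree_graph_K1: "K1_graph (X_tensor m) (X l) tree_graph"
  unfolding K1_graph_matching tree_graph_def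
proof (rule matching_labelling)
  show "u = w" if "u \<in> V" "w \<in> V" "label u = label w" "sgn u = sgn w" for u w
    using that by (rule label_inject)
  show "\<exists>w\<in>V. label u = label w \<and> sgn u \<noteq> sgn w" if "u \<in> V" for u
    using ex_positive[OF label_in_edges[OF that]] ex_negative[OF label_in_edges[OF that]] by metis
qed

lemma tree_graphI:
  "u \<in> V \<Longrightarrow> w \<in> V \<Longrightarrow> sgn u \<noteq> sgn w \<Longrightarrow> label u = label w \<Longrightarrow> (u, w) \<in> tree_graph"
  unfolding tree_graph_def by auto

lemma represents_tree_graph: "represents m l tree_graph (T, \<rho>, \<tau>)"
  unfolding represents.simps
proof (intro conjI ballI allI impI)
  show "K1_graph (X_tensor m) (X l) tree_graph" by (rule tree_graph_K1)
next
  fix a j b assume a: "a \<in> nodes T" "j < inputs T a" "b \<in> nodes T" "b = a @ [j]"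
  then have "\<tau> a < length m" "j < m ! \<tau> a" "\<tau> b < length m"
    using \<tau>_less inputs_\<tau> by auto
  then show "(A_in m (\<tau> a) j, A_out m (\<tau> b)) \<in> tree_graph"
    using a by (intro tree_graphI) (simp_all add: in_vars_X variance_simps label_simps node_at_\<tau>)
next
  fix a j q assume a: "a \<in> nodes T" "j < inputs T a" "q < length (leaves T)" "leaves T ! q = a @ [j]"
  then have "\<tau> a < length m" "j < m ! \<tau> a" "\<rho> q < l"
    using \<tau>_less inputs_\<tau> \<rho>_less length_leaves by auto
  then show "(A_in m (\<tau> a) j, B_in (\<rho> q)) \<in> tree_graph"
    using a by (intro tree_graphI)
      (simp_all add: in_vars_X variance_simps label_simps node_at_\<tau> leaf_at_\<rho>)
next
  fix a assume a: "a \<in> nodes T" "a = []"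
  then show "(A_out m (\<tau> a), B_out l) \<in> tree_graph"
    using \<tau>_less[OF a(1)] by (intro tree_graphI)
      (simp_all add: in_vars_X variance_simps label_simps node_at_\<tau> del: Nil_in_nodes)
next
  assume Null: "T = Null"
  then have l: "0 < l" using length_leaves by simp
  moreover have "leaf_at 0 = []" using leaf_at_in[OF l] Null by simp
  ultimately show "(B_in 0, B_out l) \<in> tree_graph"
    by (intro tree_graphI) (simp_all add: in_vars_X variance_simps label_simps)
qed

text \<open>The prescribed mates of a tree exhaust the pairs of variables with equal labels: a positive variable
is an input of a node or the root, a negative one an output of a node or a leaf, and each of the four
combinations is one of the prescribed cases.  A graph that contains another graph on the same
variables is equal to it.\<close>

lemma represents_iff: "represents m l \<xi> (T, \<rho>, \<tau>) \<longleftrightarrow> \<xi> = tree_graph"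
proof
  assume r: "represents m l \<xi> (T, \<rho>, \<tau>)"
  note K1 = representsD(1)[OF r] and A_A = representsD(2)[OF r] and A_B = representsD(3)[OF r]
    and root = representsD(4)[OF r] and null = representsD(5)[OF r]
  have sym: "(w, u) \<in> \<xi>" if "(u, w) \<in> \<xi>" for u w
    using K1 that unfolding K1_graph_def by (blast dest: symD)
  have pos: "(u, w) \<in> \<xi>" if "u \<in> V" "w \<in> V" "label u = label w" "sgn u" "\<not> sgn w" for u w
    using that(1,4)
  proof (cases rule: positive_cases)
    case (1 i j)
    show ?thesis using that(2,5)
    proof (cases rule: negative_cases)
      case A: (1 r)
      have "node_at r = node_at i @ [j]" using that(3) 1 A by (simp add: label_simps)
      then have "(A_in m (\<tau> (node_at i)) j, A_out m (\<tau> (node_at r))) \<in> \<xi>"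
        using A_A[of "node_at i" j] 1 node_at_in[OF A(1)] node_at_in[OF 1(1)] inputs_node_at[OF 1(1)]
        by simp
      then show ?thesis using 1 A by (simp add: \<tau>_node_at)
    next
      case B: (2 p)
      have "leaves T ! inv \<rho> p = node_at i @ [j]"
        using that(3) 1 B by (simp add: label_simps leaf_at_def)
      then have "(A_in m (\<tau> (node_at i)) j, B_in (\<rho> (inv \<rho> p))) \<in> \<xi>"
        using A_B[of "node_at i" j "inv \<rho> p"] 1 node_at_in[OF 1(1)] inputs_node_at[OF 1(1)]
          inv_\<rho>_less[OF B(1)] length_leaves by simp
      then show ?thesis using 1 B by (simp add: \<tau>_node_at permutes_inverses(1)[OF perm_\<rho>])
    qed
  next
    case 2
    show ?thesis using that(2,5)
    proof (cases rule: negative_cases)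
      case A: (1 r)
      have "node_at r = []" using that(3) 2 A by (simp add: label_simps)
      then have "(A_out m (\<tau> (node_at r)), B_out l) \<in> \<xi>"
        using root node_at_in[OF A(1)] by (simp del: Nil_in_nodes)
      then show ?thesis using 2 A sym by (simp add: \<tau>_node_at)
    next
      case B: (2 p)
      have "leaf_at p = []" using that(3) 2 B by (simp add: label_simps)
      then have Null: "T = Null" using leaf_at_in[OF B(1)] by simp
      then have "p = 0" using B(1) length_leaves by simp
      then show ?thesis using 2 B sym[OF null[OF Null]] by simp
    qed
  qed
  have "tree_graph \<subseteq> \<xi>"
  proof clarify
    fix u w assume uw: "(u, w) \<in> tree_graph"
    then have V: "u \<in> V" "w \<in> V" "label u = label w" "u \<noteq> w" by (auto simp: tree_graph_def)
    then have "sgn u \<noteq> sgn w" using label_inject by blast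
    then consider "sgn u" "\<not> sgn w" | "sgn w" "\<not> sgn u" by blast
    then show "(u, w) \<in> \<xi>"
    proof cases
      case 1
      then show ?thesis using pos V by blast
    next
      case 2
      then have "(w, u) \<in> \<xi>" using pos V by simp
      then show ?thesis by (rule sym)
    qed
  qed
  then show "\<xi> = tree_graph"
    using matching_subset_eq tree_graph_K1 K1 unfolding K1_graph_matching by metis
qed (simp only: represents_tree_graph)

lemma shape_of_atoms: "shape_of (map (\<lambda>x. atom (g x)) xs) = concat (replicate (length xs) \<one>\<^sub>s)"
  by (induction xs) simp_all

lemma labels_of_atoms: "labels_of (map (\<lambda>x. atom (g x)) xs) = map g xs"
  by (induction xs) simp_all

text \<open>The derivation of the tree supplies an allowable graph that joins only variables with equal labels;
as a matching inside the matching \<open>tree_graph\<close> it is all of it.\<close>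

lemma allowable_tree_graph: "allowable (X_tensor m) (X l) tree_graph"
proof -
  let ?ns = "map node_at [0..<length m]" and ?ls = "map leaf_at [0..<l]"
  have "distinct ?ns"
    by (auto simp: distinct_map inj_on_def node_at_inject)
  moreover have "set ?ns = set (node_list T)"
  proof -
    have "a \<in> node_at ` {..<length m}" if "a \<in> nodes T" for a
      using node_at_\<tau>[OF that] \<tau>_less[OF that] by (metis imageI lessThan_iff)
    then show ?thesis using node_at_in by (auto simp: set_node_list atLeast0LessThan)
  qed
  ultimately have ns: "mset ?ns = mset (node_list T)"
    using set_eq_iff_mset_eq_distinct[OF _ distinct_node_list] by blast
  have "distinct ?ls" using leaf_at_inject by (auto simp: distinct_map inj_on_def)
  moreover have "set ?ls = set (leaves T)"
    using leaf_at_in by (auto simp: atLeast0LessThan dest!: ex_leaf_at)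
  ultimately have ls: "mset ?ls = mset (leaves T)"
    using set_eq_iff_mset_eq_distinct[OF _ distinct_leaves] by blast
  have formula: "node_formula [] T (node_at i) =
      (X (m ! i), map (\<lambda>j. node_at i @ [j]) [0..<m ! i] @ [node_at i])" if "i < length m" for i
    using that by (simp add: node_formula_def impl_def inputs_node_at shape_of_atoms labels_of_atoms X_def)
  then have formulas: "map (node_formula [] T) ?ns =
      map (\<lambda>i. (X (m ! i), map (\<lambda>j. node_at i @ [j]) [0..<m ! i] @ [node_at i])) [0..<length m]"
    by simp
  have shape: "shape_of (map (node_formula [] T) ?ns) = X_tensor m"
    unfolding shape_of_def X_tensor_upt formulas by (simp add: o_def)
  have labels: "labels_of (map (node_formula [] T) ?ns) = dom_labels"
    unfolding labels_of_def dom_labels_def formulas by (simp add: o_def)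
  have "entails (map (node_formula [] T) ?ns) [impl (map atom ?ls) [atom []]]"
    by (rule tree_derivation[OF ns ls])
  then obtain f where f: "allowable (X_tensor m) (X l) f" "compatible f ((!) dom_labels) ((!) cod_labels)"
    unfolding entails_def shape labels
    by (auto simp: shape_of_atoms labels_of_atoms X_def cod_labels_def o_def)
  have K1: "K1_graph (X_tensor m) (X l) f" using f(1) by (rule allowable_K1)
  have "f \<subseteq> tree_graph"
    using f(2) K1 unfolding compatible_def tree_graph_def label_def K1_graph_def irrefl_def by fast
  then have "f = tree_graph"
    using matching_subset_eq tree_graph_K1 K1 unfolding K1_graph_matching by metis
  then show ?thesis using f(1) by simp
qed

end

section \<open>The tree of an allowable morphism\<close>

lemma phase_concat:
  "phase (concat (map G [0..<k])) x = (\<Sum>i<k. phase (G i) (\<lambda>n. x ((\<Sum>r<i. nv (G r)) + n)))"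
proof (induction k)
  case (Suc k)
  have "nv (concat (map G [0..<k])) = (\<Sum>r<k. nv (G r))"
    by (induction k) (simp_all add: v_unit v_tensor)
  then show ?case using Suc by (simp add: phase_tensor)
qed simp

lemma phase_X: "phase (X n) y = residual (\<Sum>j<n. y j) (y n)"
proof -
  let ?Ones = "tensor_list (replicate n \<one>\<^sub>s)"
  have ones: "?Ones = concat (map (\<lambda>_. \<one>\<^sub>s) [0..<n])" by (simp add: map_replicate_const)
  have "nv ?Ones = n" by (induction n) (simp_all add: v_unit v_tensor v_one del: append.simps)
  moreover have "phase ?Ones y = (\<Sum>j<n. y j)"
    unfolding ones phase_concat by (simp add: v_one)
  ultimately show ?thesis by (simp add: X_def)
qed

lemma phase_X_tensor:
  "phase (X_tensor m) x = (\<Sum>i<length m. residual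
     (\<Sum>j<m ! i. x ((\<Sum>r<i. m ! r + 1) + j)) (x ((\<Sum>r<i. m ! r + 1) + m ! i)))"
  unfolding X_tensor_upt phase_concat phase_X nv_X ..

lemma residual_0: "residual 0 B = B" for B :: "'a::comm_monoid_add set"
  by (simp add: residual_def)

lemma zero_in_sum: "(\<And>i. i \<in> I \<Longrightarrow> 0 \<in> S i) \<Longrightarrow> (0 :: 'a::comm_monoid_add) \<in> sum S I"
proof (induction I rule: infinite_finite_induct)
  case (insert i I)
  then show ?case using set_plus_intro[of 0 "S i" 0 "sum S I"] by simp
qed simp_all

lemma sum_eq_UNIV:
  fixes S :: "'i \<Rightarrow> 'a::comm_monoid_add set"
  assumes "finite I" "\<And>i. i \<in> I \<Longrightarrow> 0 \<in> S i" "k \<in> I" "S k = UNIV"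
  shows "sum S I = UNIV"
proof -
  have "0 \<in> sum S (I - {k})" using assms(2) by (intro zero_in_sum) auto
  then have "c \<in> UNIV + sum S (I - {k})" for c :: 'a
    using set_plus_intro[of c UNIV 0 "sum S (I - {k})"] by simp
  then show ?thesis using assms by (auto simp: sum.remove)
qed

locale allowable_graph =
  fixes m :: "nat list" and l :: nat and f :: graph
  assumes allowable: "allowable (X_tensor m) (X l) f"
begin

abbreviation V :: "variable set" where "V \<equiv> vars (X_tensor m) (X l)"
abbreviation sgn :: "variable \<Rightarrow> bool" where "sgn \<equiv> variance (X_tensor m) (X l)"

lemma K1: "K1_graph (X_tensor m) (X l) f"
  using allowable by (rule allowable_K1)

lemma matching_f: "matching V sgn f"
  using K1 unfolding K1_graph_matching .

lemmas mate_unique = matching_unique[OF matching_f]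
lemmas mate_sym = matching_sym[OF matching_f]
lemmas mate_sign = matching_sign[OF matching_f]
lemmas mate_in = matching_in[OF matching_f]

text \<open>The node \<open>r\<close> is located at the address \<open>a\<close> if its successive parents in \<open>f\<close> lead to \<open>B\<close>, and \<open>a\<close> lists
the inputs passed on the way back from \<open>B\<close>.\<close>

inductive located :: "nat \<Rightarrow> address \<Rightarrow> bool" where
  located_root: "r < length m \<Longrightarrow> (A_out m r, B_out l) \<in> f \<Longrightarrow> located r []"
| located_step: "located r a \<Longrightarrow> j < m ! r \<Longrightarrow> r' < length m \<Longrightarrow> (A_in m r j, A_out m r') \<in> f \<Longrightarrow>
    located r' (a @ [j])"

lemma located_less: "located r a \<Longrightarrow> r < length m"
  by (induction rule: located.induct)

lemma located_address_unique: "located r a \<Longrightarrow> located r b \<Longrightarrow> a = b"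
proof (induction arbitrary: b rule: located.induct)
  case (located_root r)
  from located_root.prems show ?case
  proof (cases rule: located.cases)
    case (located_step s a j)
    then show ?thesis using mate_unique[OF located_root.hyps(2) mate_sym[OF located_step(5)]] by simp
  qed simp
next
  case (located_step r a j r')
  from located_step.prems show ?case
  proof (cases rule: located.cases)
    case located_root
    then show ?thesis using mate_unique[OF _ mate_sym[OF located_step.hyps(4)]] by fastforce
  next
    case step: (located_step s c i)
    have "A_in m r j = A_in m s i"
      using mate_unique mate_sym[OF located_step.hyps(4)] mate_sym[OF step(5)] by blast
    then have "r = s" "j = i" using located_step.hyps(2) step(3) by (simp_all add: A_in_inject)
    then show ?thesis using located_step.IH step(1,2) by simp
  qed
qed

lemma located_node_unique: "located r a \<Longrightarrow> located s a \<Longrightarrow> r = s"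
proof (induction arbitrary: s rule: located.induct)
  case (located_root r)
  from located_root.prems show ?case
  proof (cases rule: located.cases)
    case root: located_root
    have "A_out m r = A_out m s"
      using mate_unique mate_sym[OF root(2)] mate_sym[OF located_root.hyps(2)] by blast
    then show ?thesis by (simp add: A_out_inject)
  qed simp
next
  case (located_step r a j r')
  from located_step.prems show ?case
  proof (cases rule: located.cases)
    case step: (located_step t c i)
    then have "r = t" "j = i" using located_step.IH[of t] by auto
    then have "A_out m r' = A_out m s" using mate_unique step(5) located_step.hyps(4) by blast
    then show ?thesis by (simp add: A_out_inject)
  qed simp
qed

text \<open>Call a node lost if it is not located; parents and children of lost nodes are lost.  Let the
outputs of the lost nodes and the mates of these outputs be interpreted by the whole monoid, and all
other variables by \<open>0\<close>, the set \<open>{0}\<close>.  The factor of a lost node is a residual into the whole monoid,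
hence the whole monoid.  For a located node neither its output nor the mates of its inputs belong to
a lost node, and its factor is \<open>{0}\<close>.  So a single lost node makes the domain the whole monoid.  But
\<open>B\<close> and all \<open>B\<^sub>p\<close> are interpreted by \<open>{0}\<close>, and so is the codomain.\<close>

lemma all_located:
  assumes "i < length m"
  shows "\<exists>a. located i a"
proof (rule ccontr)
  assume lost: "\<not> ?thesis"
  define P where "P u \<longleftrightarrow> (\<exists>r<length m. (\<forall>a. \<not> located r a) \<and> (u = A_out m r \<or> (u, A_out m r) \<in> f))" for u
  define L :: "variable \<Rightarrow> nat set" where "L u = (if P u then UNIV else 0)" for u
  have P_mate: "P w" if "(u, w) \<in> f" "P u" for u w
    using that mate_sym mate_unique unfolding P_def by metis
  then have "L u = L w" if "(u, w) \<in> f" for u w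
    using that mate_sym unfolding L_def by metis
  then have "compatible f (\<lambda>n. L (Inl n)) (\<lambda>n. L (Inr n))"
    unfolding compatible_def by (auto split: sum.splits)
  then have sub: "phase (X_tensor m) (\<lambda>n. L (Inl n)) \<subseteq> phase (X l) (\<lambda>n. L (Inr n))"
    by (rule phase_sound[OF allowable])
  have dom: "phase (X_tensor m) (\<lambda>n. L (Inl n)) =
      (\<Sum>r<length m. residual (\<Sum>j<m ! r. L (A_in m r j)) (L (A_out m r)))"
    by (simp add: phase_X_tensor A_in_def A_out_def)
  have cod: "phase (X l) (\<lambda>n. L (Inr n)) = residual (\<Sum>p<l. L (B_in p)) (L (B_out l))"
    by (simp add: phase_X B_in_def B_out_def)
  have negative: "P w \<longleftrightarrow> (\<exists>r<length m. (\<forall>a. \<not> located r a) \<and> w = A_out m r)" if "\<not> sgn w" for w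
    using that mate_sign variance_A_out unfolding P_def by metis
  have out: "P (A_out m r) \<longleftrightarrow> (\<forall>a. \<not> located r a)" if "r < length m" for r
    using that negative[OF variance_A_out[OF that]] by (auto simp: A_out_inject)
  have positive: "P w \<longleftrightarrow> (\<exists>r<length m. (\<forall>a. \<not> located r a) \<and> (w, A_out m r) \<in> f)" if "sgn w" for w
    using that variance_A_out unfolding P_def by metis
  have B_in: "L (B_in p) = 0" if "p < l" for p
    using negative[OF variance_B_in[OF that]] by (simp add: L_def)
  have B_out: "L (B_out l) = 0"
    using positive[OF variance_B_out] located_root mate_sym by (auto simp: L_def)
  have A_in: "L (A_in m r j) = 0" if "r < length m" "j < m ! r" "located r a" for r j a
    using positive[OF variance_A_in[OF that(1,2)]] located_step[OF that(3,2)] by (auto simp: L_def)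
  have unlocated: "residual (\<Sum>j<m ! r. L (A_in m r j)) (L (A_out m r)) = UNIV"
    if "r < length m" "\<forall>a. \<not> located r a" for r
    using out that by (simp add: L_def residual_def)
  have loc: "residual (\<Sum>j<m ! r. L (A_in m r j)) (L (A_out m r)) = 0"
    if "r < length m" "located r a" for r a
  proof -
    have "L (A_out m r) = 0" using out[OF that(1)] that(2) by (auto simp: L_def)
    moreover have "(\<Sum>j<m ! r. L (A_in m r j)) = 0"
      using A_in[OF that(1) _ that(2)] by (intro sum.neutral) simp
    ultimately show ?thesis by (simp only: residual_0)
  qed
  have "phase (X_tensor m) (\<lambda>n. L (Inl n)) = UNIV"
    unfolding dom
  proof (rule sum_eq_UNIV)
    show "i \<in> {..<length m}" using assms by simp
    show "residual (\<Sum>j<m ! i. L (A_in m i j)) (L (A_out m i)) = UNIV"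
      using unlocated[OF assms] lost by blast
    show "0 \<in> residual (\<Sum>j<m ! r. L (A_in m r j)) (L (A_out m r))" if "r \<in> {..<length m}" for r
      using unlocated[of r] loc[of r] that by (cases "\<exists>a. located r a") auto
  qed simp
  moreover have "phase (X l) (\<lambda>n. L (Inr n)) = 0"
  proof -
    have "(\<Sum>p<l. L (B_in p)) = 0" using B_in by (intro sum.neutral) simp
    then show ?thesis unfolding cod B_out by (simp only: residual_0)
  qed
  ultimately have "(1::nat) \<in> 0" using sub by blast
  then show False by simp
qed

lemma mate_of_positive:
  assumes "u \<in> V" "sgn u"
  obtains r where "r < length m" "(u, A_out m r) \<in> f" | p where "p < l" "(u, B_in p) \<in> f"
proof -
  obtain w where w: "(u, w) \<in> f" using matching_ex[OF matching_f assms(1)] by blast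
  then have "w \<in> V" "\<not> sgn w" using mate_in mate_sign assms(2) by blast+
  then show thesis using that w by (elim negative_cases) blast+
qed

text \<open>In a tree represented by \<open>f\<close>, the address of a node is the path by which it reaches \<open>B\<close> in \<open>f\<close>.\<close>

lemma represented_tree:
  assumes "combed_tree (T, \<rho>, \<tau>)" "tree_inputs m (T, \<rho>, \<tau>)" "represents m l f (T, \<rho>, \<tau>)"
  shows "a \<in> nodes T \<Longrightarrow> located (\<tau> a) a" and "nodes T = {a. \<exists>r. located r a}"
proof -
  have bij: "bij_betw \<tau> (nodes T) {..<length m}" and inp: "\<And>a. a \<in> nodes T \<Longrightarrow> inputs T a = m ! \<tau> a"
    using assms(1,2) by auto
  have less: "\<tau> a < length m" if "a \<in> nodes T" for a using bij_betw_apply[OF bij that] by simp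
  note A_A = representsD(2)[OF assms(3)] and root = representsD(4)[OF assms(3)]
  show loc: "located (\<tau> a) a" if "a \<in> nodes T" for a
    using that
  proof (induction a rule: rev_induct)
    case Nil
    then show ?case using located_root[OF less root] by blast
  next
    case (snoc j a)
    then have "a @ [j] \<in> edges T" by (simp add: edges_def)
    then have a: "a \<in> nodes T" "j < inputs T a" by (simp_all add: snoc_in_edges)
    then show ?case
      using located_step[OF snoc.IH[OF a(1)] _ less[OF snoc.prems] A_A[OF a snoc.prems]] inp by simp
  qed
  show "nodes T = {a. \<exists>r. located r a}"
  proof (intro equalityI subsetI CollectI)
    fix a assume "a \<in> {a. \<exists>r. located r a}"
    then obtain r where r: "located r a" by blast
    then obtain b where "b \<in> nodes T" "\<tau> b = r"
      using located_less bij unfolding bij_betw_def by (metis imageE lessThan_iff)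
    then show "a \<in> nodes T" using loc located_address_unique[OF r] by blast
  qed (use loc in blast)
qed

lemma represented_tree_unique:
  assumes T: "combed_tree (T, \<rho>, \<tau>)" "tree_inputs m (T, \<rho>, \<tau>)" "represents m l f (T, \<rho>, \<tau>)"
    and T': "combed_tree (T', \<rho>', \<tau>')" "tree_inputs m (T', \<rho>', \<tau>')" "represents m l f (T', \<rho>', \<tau>')"
  shows "(T, \<rho>, \<tau>) = (T', \<rho>', \<tau>')"
proof -
  have nodes: "nodes T = nodes T'"
    using represented_tree(2)[OF T] represented_tree(2)[OF T'] by simp
  have \<tau>: "\<tau> a = \<tau>' a" if "a \<in> nodes T" for a
    using represented_tree(1)[OF T that] represented_tree(1)[OF T', of a] that nodes
      located_node_unique by blast
  have "\<tau> = \<tau>'"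
    using \<tau> T(1) T'(1) nodes by (intro extensionalityI[of \<tau> "nodes T"]) auto
  have "T = T'"
    using T(2) T'(2) nodes \<tau> by (intro nodes_inputs_inject) auto
  have perm: "\<rho> permutes {..<length (leaves T)}" "\<rho>' permutes {..<length (leaves T)}"
    using T(1) T'(1) \<open>T = T'\<close> by auto
  have "\<rho> q = \<rho>' q" if q: "q < length (leaves T)" for q
  proof (cases "leaves T ! q" rule: rev_cases)
    case Nil
    then have "T = Null" using nth_mem[OF q] by simp
    then show ?thesis using perm permutes_in_image[OF perm(1), of q] permutes_in_image[OF perm(2), of q] q
      by simp
  next
    case (snoc a j)
    then have "a @ [j] \<in> edges T" using nth_mem[OF q] by (simp add: edges_def)
    then have a: "a \<in> nodes T" "j < inputs T a" by (simp_all add: snoc_in_edges)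
    have "(A_in m (\<tau> a) j, B_in (\<rho> q)) \<in> f" "(A_in m (\<tau> a) j, B_in (\<rho>' q)) \<in> f"
      using representsD(3)[OF T(3) a q snoc] representsD(3)[OF T'(3), of a j q] a q snoc
        \<open>\<tau> = \<tau>'\<close> \<open>T = T'\<close> by simp_all
    from mate_unique[OF this] show ?thesis by (simp add: B_in_inject)
  qed
  moreover have "\<rho> q = \<rho>' q" if "\<not> q < length (leaves T)" for q
    using permutes_not_in[OF perm(1), of q] permutes_not_in[OF perm(2), of q] that by simp
  ultimately have "\<rho> = \<rho>'" by blast
  then show ?thesis using \<open>T = T'\<close> \<open>\<tau> = \<tau>'\<close> by simp
qed

text \<open>The nodes of the tree are the locations.  Its edges correspond to their arriving ends, the positive
variables (\<open>slot\<close> below); an edge is the output of a node if the mate of its slot is some \<open>A\<^sub>r\<close>, and a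
leaf if it is some \<open>B\<^sub>p\<close>.  Since all nodes are located, every positive variable is a slot, and the
leaves are therefore in bijection with the \<open>B\<^sub>p\<close>.\<close>

lemma represented_tree_ex:
  "\<exists>T \<rho> \<tau>. combed_tree (T, \<rho>, \<tau>) \<and> tree_inputs m (T, \<rho>, \<tau>) \<and> represents m l f (T, \<rho>, \<tau>)"
proof -
  define N where "N = {a. \<exists>r. located r a}"
  define \<tau> where "\<tau> = restrict (\<lambda>a. THE r. located r a) N"
  have \<tau>: "\<tau> a = r" if "located r a" for r a
    unfolding \<tau>_def N_def using that located_node_unique by (auto intro!: the_equality)
  have \<tau>_located: "located (\<tau> a) a" if "a \<in> N" for a
    using that \<tau> unfolding N_def by auto
  have bij: "bij_betw \<tau> N {..<length m}"
    unfolding bij_betw_def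
  proof
    show "inj_on \<tau> N"
      using \<tau>_located located_address_unique by (metis inj_onI)
    show "\<tau> ` N = {..<length m}"
    proof
      show "\<tau> ` N \<subseteq> {..<length m}" using \<tau>_located located_less by auto
      show "{..<length m} \<subseteq> \<tau> ` N"
      proof
        fix r assume "r \<in> {..<length m}"
        then obtain a where "located r a" using all_located by auto
        then show "r \<in> \<tau> ` N" using \<tau> unfolding N_def by (metis (mono_tags) imageI mem_Collect_eq)
      qed
    qed
  qed
  have "finite N" using bij_betw_finite[OF bij] by simp
  moreover have "a \<in> N \<and> j < m ! \<tau> a" if aj: "a @ [j] \<in> N" for a j
  proof -
    from aj obtain r where "located r (a @ [j])" unfolding N_def by blast
    then show ?thesis
    proof (cases rule: located.cases)
      case (located_step s b i)
      then show ?thesis using \<tau>[of s a] unfolding N_def by auto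
    qed simp
  qed
  ultimately obtain T where nodes: "nodes T = N" and inputs: "\<And>a. a \<in> N \<Longrightarrow> inputs T a = m ! \<tau> a"
    using ptree_of_addresses[of N "\<lambda>a. m ! \<tau> a"] by blast
  define slot where "slot e = (if e = [] then B_out l else A_in m (\<tau> (butlast e)) (last e))" for e
  have slot: "slot [] = B_out l" "slot (a @ [j]) = A_in m (\<tau> a) j" for a j
    by (simp_all add: slot_def)
  have edge: "\<tau> a < length m" "j < m ! \<tau> a" "located (\<tau> a) a" if "a @ [j] \<in> edges T" for a j
    using that \<tau>_located[of a] located_less inputs nodes by (auto simp: snoc_in_edges)
  have slot_V: "slot e \<in> V" "sgn (slot e)" if "e \<in> edges T" for e
    using that edge by (cases e rule: rev_cases; simp add: slot in_vars_X variance_simps)+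
  have slot_inject: "e = e'" if "e \<in> edges T" "e' \<in> edges T" "slot e = slot e'" for e e'
  proof (cases e rule: rev_cases)
    case Nil
    then show ?thesis using that by (cases e' rule: rev_cases) (simp_all add: slot)
  next
    case a: (snoc a j)
    show ?thesis
    proof (cases e' rule: rev_cases)
      case Nil
      then show ?thesis using that a by (simp add: slot)
    next
      case b: (snoc b i)
      then have "\<tau> a = \<tau> b \<and> j = i" using that a edge by (simp add: slot A_in_inject)
      then show ?thesis
        using a b that edge(3)[of a j] edge(3)[of b i] located_address_unique by simp
    qed
  qed
  have slot_located: "(slot e, A_out m r) \<in> f \<longleftrightarrow> located r e" if "e \<in> edges T" "r < length m" for e r
  proof (cases e rule: rev_cases)
    case Nil
    show ?thesis
    proof
      assume "(slot e, A_out m r) \<in> f"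
      then show "located r e" using located_root[OF that(2)] mate_sym Nil by (simp add: slot)
    next
      assume "located r e"
      then show "(slot e, A_out m r) \<in> f"
        using mate_sym Nil by (cases rule: located.cases) (simp_all add: slot)
    qed
  next
    case (snoc a j)
    show ?thesis
    proof
      assume "(slot e, A_out m r) \<in> f"
      then show "located r e"
        using located_step[of "\<tau> a" a j r] edge[of a j] that snoc by (simp add: slot)
    next
      assume "located r e"
      then show "(slot e, A_out m r) \<in> f"
      proof (cases rule: located.cases)
        case (located_step s b i)
        then show ?thesis using \<tau>[of s b] snoc by (simp add: slot)
      qed (use snoc in simp)
    qed
  qed
  have slot_node: "(slot e, A_out m (\<tau> e)) \<in> f" if "e \<in> nodes T" for e
    using that slot_located[of e "\<tau> e"] \<tau>_located[of e] located_less nodes by (auto simp: edges_def)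
  have slot_leaf: "\<exists>p<l. (slot e, B_in p) \<in> f" if "e \<in> set (leaves T)" for e
  proof -
    have e: "e \<in> edges T" "e \<notin> nodes T" using that nodes_leaves_disjoint by (auto simp: edges_def)
    from slot_V[OF e(1)] show ?thesis
    proof (cases rule: mate_of_positive)
      case (1 r)
      then show ?thesis using slot_located[OF e(1)] e(2) nodes unfolding N_def by blast
    qed blast
  qed
  have leaf_of: "\<exists>e\<in>set (leaves T). (slot e, B_in p) \<in> f" if p: "p < l" for p
  proof -
    obtain u where u: "(B_in p, u) \<in> f" using matching_ex[OF matching_f in_vars_X(3)[OF p]] by blast
    have "u \<in> V" "sgn u" using mate_in[OF u] mate_sign[OF u] variance_B_in[OF p] by auto
    then obtain e where e: "e \<in> edges T" "slot e = u"
    proof (cases rule: positive_cases)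
      case (1 i j)
      obtain a where a: "located i a" using all_located[OF 1(1)] by blast
      then have "a \<in> nodes T" using nodes unfolding N_def by blast
      then have "a @ [j] \<in> edges T" using 1 \<tau>[OF a] inputs nodes by (simp add: snoc_in_edges)
      then show ?thesis using that[of "a @ [j]"] 1 \<tau>[OF a] by (simp add: slot)
    next
      case 2
      then show ?thesis using that[of "[]"] by (simp add: slot)
    qed
    have "e \<notin> nodes T"
    proof
      assume "e \<in> nodes T"
      then have "A_out m (\<tau> e) = B_in p" using slot_node mate_unique mate_sym[OF u] e(2) by blast
      then show False by simp
    qed
    then show ?thesis using e mate_sym[OF u] by (auto simp: edges_def)
  qed
  let ?n = "length (leaves T)"
  define \<rho> where "\<rho> q = (if q < ?n then SOME p. p < l \<and> (slot (leaves T ! q), B_in p) \<in> f else q)" for q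
  have \<rho>: "\<rho> q < l" "(slot (leaves T ! q), B_in (\<rho> q)) \<in> f" if "q < ?n" for q
    using someI_ex[OF slot_leaf[OF nth_mem[OF that], unfolded Bex_def]] that by (auto simp: \<rho>_def)
  have bij_\<rho>: "bij_betw \<rho> {..<?n} {..<l}"
    unfolding bij_betw_def
  proof
    show "inj_on \<rho> {..<?n}"
    proof (rule inj_onI)
      fix q q' assume q: "q \<in> {..<?n}" "q' \<in> {..<?n}" "\<rho> q = \<rho> q'"
      then have "slot (leaves T ! q) = slot (leaves T ! q')"
        using \<rho>(2)[of q] \<rho>(2)[of q'] mate_sym mate_unique by (metis lessThan_iff)
      then have "leaves T ! q = leaves T ! q'"
        using q by (intro slot_inject) (auto simp: edges_def)
      then show "q = q'" using q distinct_leaves by (simp add: nth_eq_iff_index_eq)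
    qed
    show "\<rho> ` {..<?n} = {..<l}"
    proof
      show "\<rho> ` {..<?n} \<subseteq> {..<l}" using \<rho>(1) by auto
      show "{..<l} \<subseteq> \<rho> ` {..<?n}"
      proof
        fix p assume "p \<in> {..<l}"
        then obtain q where q: "q < ?n" "(slot (leaves T ! q), B_in p) \<in> f"
          using leaf_of by (metis in_set_conv_nth lessThan_iff)
        then have "p = \<rho> q" using \<rho>(2)[OF q(1)] mate_unique by (metis B_in_inject)
        then show "p \<in> \<rho> ` {..<?n}" using q(1) by blast
      qed
    qed
  qed
  then have n: "?n = l" using bij_betw_same_card by fastforce
  have "\<rho> permutes {..<?n}"
    using bij_\<rho> n by (intro bij_imp_permutes) (auto simp: \<rho>_def)
  then have "combed_tree (T, \<rho>, \<tau>)"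
    using bij bij_betw_same_card[OF bij] nodes by (simp add: \<tau>_def)
  moreover have "tree_inputs m (T, \<rho>, \<tau>)"
    using bij_betw_same_card[OF bij] nodes inputs by simp
  moreover have "represents m l f (T, \<rho>, \<tau>)"
    unfolding represents.simps
  proof (intro conjI ballI allI impI)
    show "K1_graph (X_tensor m) (X l) f" by (rule K1)
  next
    fix a j b assume "b \<in> nodes T" "b = a @ [j]"
    then show "(A_in m (\<tau> a) j, A_out m (\<tau> b)) \<in> f" using slot_node[of b] by (simp add: slot)
  next
    fix a j q assume "q < ?n" "leaves T ! q = a @ [j]"
    then show "(A_in m (\<tau> a) j, B_in (\<rho> q)) \<in> f" using \<rho>(2)[of q] by (simp add: slot)
  next
    fix a assume "a \<in> nodes T" "a = []"
    then show "(A_out m (\<tau> a), B_out l) \<in> f"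
      using slot_node[of a] mate_sym by (simp add: slot del: Nil_in_nodes)
  next
    assume "T = Null"
    then have "\<rho> 0 < 1" "(B_out l, B_in (\<rho> 0)) \<in> f" using \<rho>[of 0] n by (auto simp: slot)
    then show "(B_in 0, B_out l) \<in> f" using mate_sym by simp
  qed
  ultimately show ?thesis by blast
qed

end

theorem proposition7p6:
  fixes m :: "nat list" and l :: nat
  assumes "int l = (\<Sum>i<length m. int (m ! i)) - int (length m) + 1"
  shows
    "(\<forall>T. combed_tree T \<and> tree_inputs m T \<longrightarrow>
        (\<exists>!\<xi>. represents m l \<xi> T) \<and>
        (\<forall>\<xi>. represents m l \<xi> T \<longrightarrow> allowable (X_tensor m) (X l) \<xi>)) \<and>
     (\<forall>f. allowable (X_tensor m) (X l) f \<longrightarrow>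
        (\<exists>!T. combed_tree T \<and> tree_inputs m T \<and> represents m l f T))"
proof (intro conjI allI impI)
  fix T :: tree assume T: "combed_tree T \<and> tree_inputs m T"
  obtain t \<rho> \<tau> where T_eq: "T = (t, \<rho>, \<tau>)" by (cases T)
  interpret numbered_tree m l t \<rho> \<tau>
    using T assms unfolding T_eq by unfold_locales auto
  show "\<exists>!\<xi>. represents m l \<xi> T" unfolding T_eq represents_iff by simp
  show "allowable (X_tensor m) (X l) \<xi>" if "represents m l \<xi> T" for \<xi>
    using that allowable_tree_graph unfolding T_eq represents_iff by simp
next
  fix f assume "allowable (X_tensor m) (X l) f"
  then interpret allowable_graph m l f by unfold_locales
  obtain t \<rho> \<tau> where "combed_tree (t, \<rho>, \<tau>)" "tree_inputs m (t, \<rho>, \<tau>)" "represents m l f (t, \<rho>, \<tau>)"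
    using represented_tree_ex by blast
  then show "\<exists>!T. combed_tree T \<and> tree_inputs m T \<and> represents m l f T"
    using represented_tree_unique by (intro ex1I[of _ "(t, \<rho>, \<tau>)"]) (auto simp del: represents.simps combed_tree.simps tree_inputs.simps)
qed

end
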